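(* Let $\tau=\tau^{(n)}\in(0,1)$ be a deterministic sequence. If $\tau\ge\tau_n$ and $\tau\to0$, and $p_n\to\infty$ with $p_n=o(n)$, then there exists a large enough $L>0$ such that $$\liminf_{n\to\infty}\inf_{\theta_0\in\ell_0[p_n]}P_{\theta_0}\bigl(\theta_0\in\hat C_n(L,\tau)\bigr)\ge1-\alpha.$$
   Context: Model: $Y^n=(Y_1,\dots,Y_n)$ with $Y_i=\theta_{0,i}+\varepsilon_i$, $\varepsilon_i$ i.i.d. $N(0,1)$; $P_{\theta_0}$ is the law of $Y^n$. $\ell_0[p]=\{\theta\in\mathbb R^n:\#\{i:\theta_i\ne0\}\le p\}$, and $\tau_n=(p_n/n)\sqrt{\log(n/p_n)}$. Horseshoe prior given $\tau>0$: independently over $i$, $\theta_i\mid\lambda_i,\tau\sim N(0,\lambda_i^2\tau^2)$ with $\lambda_i$ standard half-Cauchy (density $\frac{2}{\pi(1+\lambda^2)}$ on $(0,\infty)$). In the Bayesian model $Y_i\mid\theta_i\sim N(\theta_i,1)$ independently; $\Pi(\cdot\mid Y^n,\tau)$ is the posterior of $\theta$. Credible ball: for fixed $\alpha\in(0,1)$, $\hat\theta(\tau)=E(\theta\mid Y^n,\tau)$ is the posterior mean, $\hat r(\alpha,\tau)$ is determined by $\Pi(\theta:\|\theta-\hat\theta(\tau)\|_2\le\hat r(\alpha,\tau)\mid Y^n,\tau)=1-\alpha$, and $\hat C_n(L,\tau)=\{\theta\in\mathbb R^n:\|\theta-\hat\theta(\tau)\|_2\le L\,\hat r(\alpha,\tau)\}$.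 *)

theory Defs
  imports "HOL-Probability.Probability" "HOL-Library.Landau_Symbols"
begin

text \<open>
  Vectors in \<open>\<real>\<^sup>n\<close>, with \<open>n\<close> varying, are the functions in the space of
  \<open>\<Pi>\<^sub>M i\<in>{1..n}. borel\<close>, i.e. functions \<open>nat \<Rightarrow> real\<close> that are \<open>undefined\<close> outside \<open>{1..n}\<close>.
  The parameter \<open>\<sigma>\<close> of \<^const>\<open>normal_density\<close> is a standard deviation.
\<close>

definition l2_dist :: "nat \<Rightarrow> (nat \<Rightarrow> real) \<Rightarrow> (nat \<Rightarrow> real) \<Rightarrow> real" where
  "l2_dist n \<theta> \<theta>' = L2_set (\<lambda>i. \<theta> i - \<theta>' i) {1..n}"

definition sparse_vectors :: "nat \<Rightarrow> nat \<Rightarrow> (nat \<Rightarrow> real) set" where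
  "sparse_vectors n p = {\<theta> \<in> {1..n} \<rightarrow>\<^sub>E UNIV. card {i \<in> {1..n}. \<theta> i \<noteq> 0} \<le> p}"

definition tau_rate :: "(nat \<Rightarrow> nat) \<Rightarrow> nat \<Rightarrow> real" where
  "tau_rate p n = (real (p n) / real n) * sqrt (ln (real n / real (p n)))"

definition data_law :: "nat \<Rightarrow> (nat \<Rightarrow> real) \<Rightarrow> (nat \<Rightarrow> real) measure" where
  "data_law n \<theta> = (\<Pi>\<^sub>M i\<in>{1..n}. density lborel (normal_density (\<theta> i) 1))"

definition half_cauchy :: "real measure" where
  "half_cauchy = density lborel (\<lambda>l. ennreal (if 0 < l then 2 / (pi * (1 + l\<^sup>2)) else 0))"

text \<open>
  The law of one coordinate is the mixture of \<open>N(0, l\<^sup>2 \<tau>\<^sup>2)\<close> over a half-Cauchy \<open>l\<close>. At \<open>l = 0\<close>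
  the kernel below is the null measure, which does not matter since \<^const>\<open>half_cauchy\<close> has no
  mass there.
\<close>

definition horseshoe_coord :: "real \<Rightarrow> real measure" where
  "horseshoe_coord \<tau> =
     half_cauchy \<bind> (\<lambda>l. density lborel (normal_density 0 (l * \<tau>)))"

definition horseshoe_prior :: "nat \<Rightarrow> real \<Rightarrow> (nat \<Rightarrow> real) measure" where
  "horseshoe_prior n \<tau> = (\<Pi>\<^sub>M i\<in>{1..n}. horseshoe_coord \<tau>)"

definition likelihood :: "nat \<Rightarrow> (nat \<Rightarrow> real) \<Rightarrow> (nat \<Rightarrow> real) \<Rightarrow> real" where
  "likelihood n y \<theta> = (\<Prod>i\<in>{1..n}. normal_density (\<theta> i) 1 (y i))"

text \<open>
  The conditional law of \<open>\<theta>\<close> given \<open>Y\<^sup>n = y\<close> is only determined for almost all \<open>y\<close>; as usual,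
  the version given by Bayes' formula is taken, which is defined for every \<open>y\<close>.
\<close>

definition posterior :: "nat \<Rightarrow> real \<Rightarrow> (nat \<Rightarrow> real) \<Rightarrow> (nat \<Rightarrow> real) measure" where
  "posterior n \<tau> y =
     density (horseshoe_prior n \<tau>)
       (\<lambda>\<theta>. ennreal (likelihood n y \<theta> / (\<integral>\<theta>'. likelihood n y \<theta>' \<partial>horseshoe_prior n \<tau>)))"

definition posterior_mean :: "nat \<Rightarrow> real \<Rightarrow> (nat \<Rightarrow> real) \<Rightarrow> (nat \<Rightarrow> real)" where
  "posterior_mean n \<tau> y = (\<lambda>i\<in>{1..n}. \<integral>\<theta>. \<theta> i \<partial>posterior n \<tau> y)"

text \<open>
  For \<open>n \<ge> 1\<close>, \<open>\<tau> > 0\<close> and \<open>0 < \<alpha> < 1\<close> there is exactly one such radius: the posterior has a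
  Lebesgue density that is positive everywhere, so its mass on centred balls is continuous and
  strictly increasing in the radius.
\<close>

definition credible_radius :: "nat \<Rightarrow> real \<Rightarrow> real \<Rightarrow> (nat \<Rightarrow> real) \<Rightarrow> real" where
  "credible_radius n \<alpha> \<tau> y =
     (THE r. measure (posterior n \<tau> y)
               {\<theta> \<in> space (posterior n \<tau> y). l2_dist n \<theta> (posterior_mean n \<tau> y) \<le> r} = 1 - \<alpha>)"

definition credible_ball :: "nat \<Rightarrow> real \<Rightarrow> real \<Rightarrow> real \<Rightarrow> (nat \<Rightarrow> real) \<Rightarrow> (nat \<Rightarrow> real) set" where
  "credible_ball n \<alpha> L \<tau> y =
     {\<theta> \<in> {1..n} \<rightarrow>\<^sub>E UNIV. l2_dist n \<theta> (posterior_mean n \<tau> y) \<le> L * credible_radius n \<alpha> \<tau> y}"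

end

theory Submission
  imports Defs "HOL-Real_Asymp.Real_Asymp"
begin

text \<open>
  Write \<open>\<zeta>\<^sub>\<tau> = sqrt (2 ln (1 / \<tau>))\<close>. Given the local scale \<open>l\<close>, everything is Gaussian, and the
  posterior mean of a coordinate is \<open>y\<close> times a posterior average of the shrinkage factor
  \<open>(l \<tau>)\<^sup>2 / (1 + (l \<tau>)\<^sup>2)\<close>, whose prior mean is at most \<open>\<tau>\<close>. This bounds the risk of the posterior
  mean by a multiple of \<open>\<tau> \<zeta>\<^sub>\<tau>\<close> at a zero coordinate and of \<open>\<zeta>\<^sub>\<tau>\<^sup>2\<close> at any other, so that the
  total squared error is of order \<open>n \<tau> \<zeta>\<^sub>\<tau>\<close> in expectation, the nonzero coordinates being negligible by
  \<open>\<tau> \<ge> \<tau>\<^sub>n\<close>.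

  Conversely, for data \<open>y\<close> between \<open>1\<close> and \<open>\<zeta>\<^sub>\<tau>\<close> the posterior variance of a coordinate, even after
  truncation at \<open>\<zeta>\<^sub>\<tau>\<^sup>2\<close>, is at least a multiple of \<open>\<tau>\<close> divided by the standard normal density at \<open>y\<close>,
  so the zero coordinates contribute a total of order \<open>n \<tau> \<zeta>\<^sub>\<tau>\<close> in expectation. A lower-tail bound for sums
  of independent variables with values in \<open>[0, \<zeta>\<^sub>\<tau>\<^sup>2]\<close>, used once under the data law and once under the
  posterior, makes the squared credible radius of order \<open>n \<tau> \<zeta>\<^sub>\<tau>\<close> with probability tending to one.
  Markov's inequality for the squared error then gives coverage once \<open>L\<close> is a large multiple of
  \<open>1 / sqrt \<alpha>\<close>.
\<close>

subsection \<open>The half-Cauchy law and the shrinkage factor\<close>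

lemma arctan_scaled_DERIV:
  "((\<lambda>x. arctan (c * x)) has_real_derivative c / (1 + c\<^sup>2 * x\<^sup>2)) (at x)"
  by (auto intro!: derivative_eq_intros simp: field_simps power_mult_distrib)

lemma nn_integral_cauchy_kernel:
  assumes "0 < c"
  shows "(\<integral>\<^sup>+x. ennreal (c / (1 + c\<^sup>2 * x\<^sup>2)) * indicator {0..} x \<partial>lborel) = ennreal (pi / 2)"
proof -
  have lim: "((\<lambda>x. arctan (c * x)) \<longlongrightarrow> pi / 2) at_top"
    by (rule filterlim_compose[OF tendsto_arctan_at_top])
       (rule filterlim_tendsto_pos_mult_at_top[OF tendsto_const assms filterlim_ident])
  have "(\<integral>\<^sup>+x. ennreal (c / (1 + c\<^sup>2 * x\<^sup>2)) * indicator {0..} x \<partial>lborel) = ennreal (pi / 2 - arctan (c * 0))"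
    by (rule nn_integral_FTC_atLeast[OF _ arctan_scaled_DERIV _ lim]) (use assms in auto)
  then show ?thesis by simp
qed

lemma sets_half_cauchy [simp, measurable_cong]: "sets half_cauchy = sets borel"
  by (simp add: half_cauchy_def)

lemma space_half_cauchy [simp]: "space half_cauchy = UNIV"
  by (simp add: half_cauchy_def)

text \<open>The closed half-line matches the integrand of \<open>nn_integral_cauchy_kernel\<close>;
  the added point 0 is Lebesgue null.\<close>

lemma nn_integral_half_cauchy:
  assumes [measurable]: "f \<in> borel_measurable borel"
  shows "(\<integral>\<^sup>+l. f l \<partial>half_cauchy) =
    (\<integral>\<^sup>+l. ennreal (2 / (pi * (1 + l\<^sup>2))) * f l * indicator {0..} l \<partial>lborel)"
proof -
  have "(\<integral>\<^sup>+l. f l \<partial>half_cauchy) =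
      (\<integral>\<^sup>+l. ennreal (if 0 < l then 2 / (pi * (1 + l\<^sup>2)) else 0) * f l \<partial>lborel)"
    unfolding half_cauchy_def by (rule nn_integral_density) auto
  also have "\<dots> = (\<integral>\<^sup>+l. ennreal (2 / (pi * (1 + l\<^sup>2))) * f l * indicator {0..} l \<partial>lborel)"
    by (rule nn_integral_cong_AE)
       (use AE_lborel_singleton[of "0::real"] in \<open>eventually_elim, auto split: split_indicator\<close>)
  finally show ?thesis .
qed

lemma prob_space_half_cauchy: "prob_space half_cauchy"
proof
  have "emeasure half_cauchy (space half_cauchy) = (\<integral>\<^sup>+l. 1 \<partial>half_cauchy)"
    by simp
  also have "\<dots> = (\<integral>\<^sup>+l. ennreal (2 / pi) * (ennreal (1 / (1 + 1\<^sup>2 * l\<^sup>2)) * indicator {0..} l) \<partial>lborel)"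
    by (subst nn_integral_half_cauchy)
       (auto intro!: nn_integral_cong simp: ennreal_mult[symmetric] split: split_indicator)
  also have "\<dots> = ennreal (2 / pi) * ennreal (pi / 2)"
    by (subst nn_integral_cmult) (use nn_integral_cauchy_kernel[of 1] in auto)
  also have "\<dots> = 1" by (simp add: ennreal_mult[symmetric])
  finally show "emeasure half_cauchy (space half_cauchy) = 1" .
qed

interpretation half_cauchy: prob_space half_cauchy by (rule prob_space_half_cauchy)

lemma AE_half_cauchy_pos: "AE l in half_cauchy. 0 < l"
  unfolding half_cauchy_def by (subst AE_density) (auto split: if_splits)

text \<open>The density is at least 1 / (8 A^2) on an interval of length A. This polynomial tail is
  what drives \<open>evidence_ge_tail\<close> and \<open>horseshoe_coord_Icc_ge\<close>.\<close>

lemma half_cauchy_Icc: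
  assumes "1 \<le> A"
  shows "measure half_cauchy {A..2 * A} \<ge> 1 / (8 * A)"
proof -
  have "ennreal (1 / (8 * A)) = (\<integral>\<^sup>+l. ennreal (1 / (8 * A\<^sup>2)) * indicator {A..2 * A} l \<partial>lborel)"
    using assms by (subst nn_integral_cmult_indicator)
      (auto simp: ennreal_mult[symmetric] power2_eq_square field_simps)
  also have "\<dots> \<le> (\<integral>\<^sup>+l. ennreal (2 / (pi * (1 + l\<^sup>2))) * indicator {A..2 * A} l * indicator {0..} l \<partial>lborel)"
  proof (rule nn_integral_mono)
    fix l :: real
    have "1 / (8 * A\<^sup>2) \<le> 2 / (pi * (1 + l\<^sup>2))" if "A \<le> l" "l \<le> 2 * A"
    proof -
      \<comment> \<open>With 3.2 in place of \<open>pi\<close>, the comparison with 16 A^2 reduces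
        to 1 \<le> A^2.\<close>
      have "pi * (1 + l\<^sup>2) \<le> 3.2 * (1 + (2 * A)\<^sup>2)"
        using that assms pi_approx by (intro mult_mono add_left_mono power_mono) auto
      also have "\<dots> \<le> 2 * (8 * A\<^sup>2)"
        using assms one_le_power[of A 2] by (simp add: power_mult_distrib)
      finally have "pi * (1 + l\<^sup>2) \<le> 2 * (8 * A\<^sup>2)" .
      then show ?thesis
        using assms by (simp add: divide_simps add_pos_nonneg)
    qed
    then show "ennreal (1 / (8 * A\<^sup>2)) * indicator {A..2 * A} l
        \<le> ennreal (2 / (pi * (1 + l\<^sup>2))) * indicator {A..2 * A} l * indicator {0..} l"
      using assms by (auto split: split_indicator intro!: ennreal_leI)
  qed
  also have "\<dots> = emeasure half_cauchy {A..2 * A}"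
    by (subst nn_integral_half_cauchy[symmetric]) auto
  finally show ?thesis
    by (simp add: half_cauchy.emeasure_eq_measure)
qed

text \<open>Given \<open>l\<close> and the observation \<open>y\<close>, the coordinate is normal
  with mean \<open>shrinkage \<tau> l * y\<close> and variance \<open>shrinkage \<tau> l\<close>;
  see \<open>normal_density_product\<close>.\<close>

definition shrinkage :: "real \<Rightarrow> real \<Rightarrow> real" where
  "shrinkage \<tau> l = (l * \<tau>)\<^sup>2 / (1 + (l * \<tau>)\<^sup>2)"

lemma one_plus_sq_pos [simp]: "0 < 1 + (x::real)\<^sup>2"
  by (simp add: add_pos_nonneg)

lemma one_plus_sq_mult_pos [simp]: "0 < 1 + (x::real)\<^sup>2 * y\<^sup>2"
  by (simp add: add_pos_nonneg)

lemma shrinkage_bounds: "0 \<le> shrinkage \<tau> l" "shrinkage \<tau> l < 1"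
  by (auto simp: shrinkage_def divide_simps)

lemma measurable_shrinkage [measurable]: "shrinkage \<tau> \<in> borel_measurable borel"
  unfolding shrinkage_def by measurable

lemma one_minus_shrinkage: "1 - shrinkage \<tau> l = 1 / (1 + (l * \<tau>)\<^sup>2)"
  using less_imp_neq[OF one_plus_sq_mult_pos[of l \<tau>], symmetric]
  by (simp add: shrinkage_def power_mult_distrib divide_simps)

lemma integrable_half_cauchy_bounded:
  fixes f :: "real \<Rightarrow> real"
  assumes "f \<in> borel_measurable borel" "\<And>l. \<bar>f l\<bar> \<le> B"
  shows "integrable half_cauchy f"
  by (rule half_cauchy.integrable_const_bound[of _ B])
     (use assms in \<open>auto simp: measurable_cong_sets[OF sets_half_cauchy refl]\<close>)

text \<open>The factor l^2 of the shrinkage cancels against 1 + l^2 in the half-Cauchy density up to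
  a factor of at most 1. What remains is \<open>2 * \<tau> / pi\<close> times a Cauchy kernel of
  total mass \<open>pi / 2\<close>.\<close>

lemma integral_shrinkage_le:
  assumes "0 < \<tau>"
  shows "(\<integral>l. shrinkage \<tau> l \<partial>half_cauchy) \<le> \<tau>"
proof -
  have "(\<integral>\<^sup>+l. ennreal (shrinkage \<tau> l) \<partial>half_cauchy) =
      (\<integral>\<^sup>+l. ennreal (2 / (pi * (1 + l\<^sup>2))) * ennreal (shrinkage \<tau> l) * indicator {0..} l \<partial>lborel)"
    by (rule nn_integral_half_cauchy) measurable
  also have "\<dots> \<le> (\<integral>\<^sup>+l. ennreal (2 * \<tau> / pi) * (ennreal (\<tau> / (1 + \<tau>\<^sup>2 * l\<^sup>2)) * indicator {0..} l) \<partial>lborel)"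
  proof (rule nn_integral_mono)
    fix l :: real
    have "2 / (pi * (1 + l\<^sup>2)) * shrinkage \<tau> l
        = (l\<^sup>2 / (1 + l\<^sup>2)) * (2 * \<tau> / pi * (\<tau> / (1 + \<tau>\<^sup>2 * l\<^sup>2)))"
      by (simp add: shrinkage_def power_mult_distrib power2_eq_square mult_ac)
    also have "\<dots> \<le> 1 * (2 * \<tau> / pi * (\<tau> / (1 + \<tau>\<^sup>2 * l\<^sup>2)))"
      using assms one_plus_sq_pos[of "\<tau> * l"] one_plus_sq_pos[of l]
      by (intro mult_right_mono) (auto simp: divide_simps power_mult_distrib simp del: one_plus_sq_pos)
    finally show "ennreal (2 / (pi * (1 + l\<^sup>2))) * ennreal (shrinkage \<tau> l) * indicator {0..} l
        \<le> ennreal (2 * \<tau> / pi) * (ennreal (\<tau> / (1 + \<tau>\<^sup>2 * l\<^sup>2)) * indicator {0..} l)"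
      using assms shrinkage_bounds(1)[of \<tau> l]
      by (auto simp: ennreal_mult[symmetric] add_nonneg_nonneg split: split_indicator intro!: ennreal_leI)
  qed
  also have "\<dots> = ennreal (2 * \<tau> / pi) * ennreal (pi / 2)"
    by (subst nn_integral_cmult) (use nn_integral_cauchy_kernel[OF assms] in auto)
  also have "\<dots> = ennreal \<tau>" using assms by (simp add: ennreal_mult[symmetric])
  finally have "(\<integral>\<^sup>+l. ennreal (shrinkage \<tau> l) \<partial>half_cauchy) \<le> ennreal \<tau>" .
  then show ?thesis
    by (intro integral_real_bounded) (use assms in auto)
qed

lemma half_cauchy_unit_interval: "measure half_cauchy {0..1} = 1 / 2"
proof -
  have "emeasure half_cauchy {0..1} = (\<integral>\<^sup>+l. indicator {0..1} l \<partial>half_cauchy)" by simp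
  also have "\<dots> = (\<integral>\<^sup>+l. ennreal (2 / pi / (1 + l\<^sup>2)) * indicator {0..1} l \<partial>lborel)"
    by (subst nn_integral_half_cauchy) (auto intro!: nn_integral_cong split: split_indicator)
  also have "\<dots> = ennreal (2 / pi * arctan 1 - 2 / pi * arctan 0)"
    by (rule nn_integral_FTC_Icc)
       (auto intro!: derivative_eq_intros simp: divide_simps add_nonneg_nonneg)
  also have "2 / pi * arctan 1 - 2 / pi * arctan 0 = (1 / 2 :: real)" by (simp add: arctan_one)
  finally show ?thesis 
    by (subst (asm) half_cauchy.emeasure_eq_measure, subst (asm) ennreal_inj) auto
qed

lemma integral_sqrt_shrinkage_ge:
  assumes "0 < \<tau>" "\<tau> \<le> 1"
  shows "(\<integral>l. sqrt (1 - shrinkage \<tau> l) \<partial>half_cauchy) \<ge> 1 / 3"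
proof -
  \<comment> \<open>Scales up to 1 have mass 1/2. There one minus the shrinkage is at least 1/2, and
    its square root exceeds 2/3.\<close>
  have "1 / 3 \<le> (\<integral>l. (2 / 3 :: real) * indicator {0..1} l \<partial>half_cauchy)"
    using half_cauchy_unit_interval by simp
  also have "\<dots> \<le> (\<integral>l. sqrt (1 - shrinkage \<tau> l) \<partial>half_cauchy)"
  proof (rule integral_mono)
    show "integrable half_cauchy (\<lambda>l. (2 / 3) * indicator {0..1} l :: real)"
      by (rule integrable_half_cauchy_bounded[of _ 1]) (auto split: split_indicator)
    show "integrable half_cauchy (\<lambda>l. sqrt (1 - shrinkage \<tau> l))"
      using shrinkage_bounds[of \<tau>]
      by (intro integrable_half_cauchy_bounded[of _ 1]) (auto simp: less_imp_le abs_of_nonneg)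
    fix l :: real
    have "2 / 3 \<le> sqrt (1 - shrinkage \<tau> l)" if "0 \<le> l" "l \<le> 1"
    proof (rule real_le_rsqrt)
      have "(l * \<tau>)\<^sup>2 \<le> 1"
        using that assms by (intro power_le_one) (auto intro: mult_le_one)
      then show "(2 / 3)\<^sup>2 \<le> 1 - shrinkage \<tau> l"
        unfolding one_minus_shrinkage
        using one_plus_sq_mult_pos[of l \<tau>] by (simp add: power_mult_distrib divide_simps)
    qed
    then show "(2 / 3) * indicator {0..1} l \<le> sqrt (1 - shrinkage \<tau> l)"
      using shrinkage_bounds[of \<tau> l] by (auto split: split_indicator)
  qed
  finally show ?thesis .
qed

subsection \<open>The posterior of one coordinate\<close>

lemma normal_density_minus_sd: "normal_density \<mu> (- \<sigma>) = normal_density \<mu> \<sigma>"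
  by (simp add: normal_density_def fun_eq_iff)

text \<open>The kernel has to be a subprobability for every \<open>l\<close>, also outside the
  support of \<open>half_cauchy\<close>. Deviation 0 gives the null measure through division by
  zero, and a negative deviation acts like its absolute value.\<close>

lemma subprob_space_normal_density: "subprob_space (density lborel (normal_density \<mu> \<sigma>))"
proof (cases "\<sigma> = 0")
  case True
  then show ?thesis
    by (intro subprob_spaceI) (auto simp: emeasure_density normal_density_def)
next
  case False
  then have "prob_space (density lborel (normal_density \<mu> \<bar>\<sigma>\<bar>))"
    by (intro prob_space_normal_density) auto
  moreover have "normal_density \<mu> \<bar>\<sigma>\<bar> = normal_density \<mu> \<sigma>"
    by (auto simp: abs_if normal_density_minus_sd)
  ultimately show ?thesis by (simp add: prob_space_imp_subprob_space)
qed

lemma measurable_normal_density_sd [measurable]: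
  assumes [measurable]: "f \<in> borel_measurable M" "g \<in> borel_measurable M" "h \<in> borel_measurable M"
  shows "(\<lambda>x. normal_density (f x) (g x) (h x)) \<in> borel_measurable M"
  unfolding normal_density_def by measurable

lemma measurable_normal_kernel [measurable]:
  "(\<lambda>l. density lborel (normal_density 0 (l * \<tau>))) \<in> borel \<rightarrow>\<^sub>M subprob_algebra borel"
proof (rule measurable_subprob_algebra)
  fix A :: "real set" assume [measurable]: "A \<in> sets borel"
  have "(\<lambda>l. \<integral>\<^sup>+x. ennreal (normal_density 0 (l * \<tau>) x) * indicator A x \<partial>lborel) \<in> borel_measurable borel"
    by measurable
  then show "(\<lambda>l. emeasure (density lborel (normal_density 0 (l * \<tau>))) A) \<in> borel_measurable borel"
    by (simp add: emeasure_density)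
qed (auto intro: subprob_space_normal_density)

lemma measurable_normal_kernel_half_cauchy [measurable]:
  "(\<lambda>l. density lborel (normal_density 0 (l * \<tau>))) \<in> half_cauchy \<rightarrow>\<^sub>M subprob_algebra borel"
  using measurable_normal_kernel by (simp cong: measurable_cong_sets)

lemma sets_horseshoe_coord [simp, measurable_cong]: "sets (horseshoe_coord \<tau>) = sets borel"
  unfolding horseshoe_coord_def by (rule sets_bind) auto

lemma space_horseshoe_coord [simp]: "space (horseshoe_coord \<tau>) = UNIV"
  using sets_eq_imp_space_eq[OF sets_horseshoe_coord[of \<tau>]] by simp

lemma emeasure_horseshoe_coord:
  assumes "A \<in> sets borel"
  shows "emeasure (horseshoe_coord \<tau>) A =
    (\<integral>\<^sup>+l. emeasure (density lborel (normal_density 0 (l * \<tau>))) A \<partial>half_cauchy)"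
  unfolding horseshoe_coord_def by (rule emeasure_bind) (use assms in auto)

lemma prob_space_horseshoe_coord:
  assumes "0 < \<tau>"
  shows "prob_space (horseshoe_coord \<tau>)"
proof
  have "emeasure (horseshoe_coord \<tau>) UNIV = (\<integral>\<^sup>+l. 1 \<partial>half_cauchy)"
  proof (subst emeasure_horseshoe_coord, simp, rule nn_integral_cong_AE)
    show "AE l in half_cauchy. emeasure (density lborel (normal_density 0 (l * \<tau>))) UNIV = 1"
      using AE_half_cauchy_pos
    proof eventually_elim
      case (elim l)
      interpret prob_space "density lborel (normal_density 0 (l * \<tau>))"
        using elim assms by (intro prob_space_normal_density) auto
      show ?case using emeasure_space_1 by simp
    qed
  qed
  then show "emeasure (horseshoe_coord \<tau>) (space (horseshoe_coord \<tau>)) = 1"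
    using half_cauchy.emeasure_space_1 by simp
qed

text \<open>Boundedness of \<open>f\<close> is the form of integrability that
  \<open>integral_join\<close> asks for. It covers the two integrands of interest, the likelihood
  and \<theta> times the likelihood, which are bounded in \<theta>.\<close>

lemma integral_horseshoe_coord:
  fixes f :: "real \<Rightarrow> real"
  assumes [measurable]: "f \<in> borel_measurable borel" and bounded: "\<And>x. \<bar>f x\<bar> \<le> B"
  shows "(\<integral>\<theta>. f \<theta> \<partial>horseshoe_coord \<tau>) =
    (\<integral>l. (\<integral>\<theta>. normal_density 0 (l * \<tau>) \<theta> * f \<theta> \<partial>lborel) \<partial>half_cauchy)"
proof -
  let ?k = "\<lambda>l. density lborel (\<lambda>x. ennreal (normal_density 0 (l * \<tau>) x))"
  let ?D = "distr half_cauchy (subprob_algebra borel) ?k"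
  have "(\<integral>\<theta>. f \<theta> \<partial>horseshoe_coord \<tau>) = integral\<^sup>L (join ?D) f"
    unfolding horseshoe_coord_def by (subst bind_nonempty''[where N = borel]) auto
  also have "\<dots> = (\<integral>M'. integral\<^sup>L M' f \<partial>?D)"
  proof (rule integral_join[where N = borel and B = B and B' = 1])
    interpret D: prob_space ?D by (rule half_cauchy.prob_space_distr) measurable
    show "finite_measure ?D" by unfold_locales
    show "AE M' in ?D. emeasure M' (space M') \<le> ennreal 1"
    proof (rule AE_I2)
      fix M' assume "M' \<in> space ?D"
      then interpret subprob_space M' by (simp add: space_subprob_algebra)
      show "emeasure M' (space M') \<le> ennreal 1" using emeasure_space_le_1 by simp
    qed
  qed (use bounded in auto)
  also have "\<dots> = (\<integral>l. integral\<^sup>L (?k l) f \<partial>half_cauchy)"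
    by (rule integral_distr) (auto intro!: integral_measurable_subprob_algebra)
  also have "\<dots> = (\<integral>l. (\<integral>\<theta>. normal_density 0 (l * \<tau>) \<theta> * f \<theta> \<partial>lborel) \<partial>half_cauchy)"
    by (rule Bochner_Integration.integral_cong[OF refl]) (simp add: integral_density)
  finally show ?thesis .
qed

text \<open>The density of an observation given the local scale, with the coordinate \<theta>
  integrated out.\<close>

definition marginal_density :: "real \<Rightarrow> real \<Rightarrow> real \<Rightarrow> real" where
  "marginal_density \<tau> y l = normal_density 0 (sqrt (1 + (l * \<tau>)\<^sup>2)) y"

lemma marginal_density_eq:
  "marginal_density \<tau> y l =
    sqrt (1 - shrinkage \<tau> l) * exp (- y\<^sup>2 * (1 - shrinkage \<tau> l) / 2) / sqrt (2 * pi)"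
  unfolding marginal_density_def normal_density_def one_minus_shrinkage
  by (simp add: real_sqrt_mult real_sqrt_divide mult.commute)

lemma measurable_marginal_density [measurable]:
  "marginal_density \<tau> y \<in> borel_measurable borel"
  unfolding marginal_density_def by measurable

lemma marginal_density_pos: "0 < marginal_density \<tau> y l"
  unfolding marginal_density_def by (rule normal_density_pos) simp

lemma sqrt_2pi_ge_1: "1 \<le> sqrt (2 * pi)"
  using pi_gt3 by simp

lemma marginal_density_le_1: "marginal_density \<tau> y l \<le> 1"
proof -
  have "sqrt (1 - shrinkage \<tau> l) * exp (- y\<^sup>2 * (1 - shrinkage \<tau> l) / 2) / sqrt (2 * pi) \<le> 1 * 1 / 1"
    using shrinkage_bounds[of \<tau> l] sqrt_2pi_ge_1 by (intro frac_le mult_mono) auto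
  then show ?thesis by (simp add: marginal_density_eq)
qed

lemma normal_density_product:
  assumes "l * \<tau> \<noteq> 0"
  shows "normal_density 0 (l * \<tau>) \<theta> * normal_density \<theta> 1 y =
    marginal_density \<tau> y l * normal_density (shrinkage \<tau> l * y) (sqrt (shrinkage \<tau> l)) \<theta>"
proof -
  define v where "v = (l * \<tau>)\<^sup>2"
  have v: "0 < v" using assms by (simp add: v_def)
  have [simp]: "sqrt (1 + v) \<noteq> 0" "1 + v \<noteq> 0" using v by auto
  have s: "shrinkage \<tau> l = v / (1 + v)" by (simp add: shrinkage_def v_def)
  have c: "sqrt (2 * pi * v) * sqrt (2 * pi) = sqrt (2 * pi * (1 + v)) * sqrt (2 * pi * (v / (1 + v)))"
    unfolding real_sqrt_mult[symmetric] using v by (intro arg_cong[of _ _ sqrt]) simp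
  \<comment> \<open>Completing the square; over the common denominator 2 v (1 + v) this is a
    polynomial identity.\<close>
  have e: "- \<theta>\<^sup>2 / (2 * v) - (y - \<theta>)\<^sup>2 / 2 =
      - y\<^sup>2 / (2 * (1 + v)) - (\<theta> - v / (1 + v) * y)\<^sup>2 / (2 * (v / (1 + v)))"
  proof -
    have "(\<theta> - v / (1 + v) * y)\<^sup>2 / (2 * (v / (1 + v))) = ((1 + v) * \<theta> - v * y)\<^sup>2 / (2 * v * (1 + v))"
    proof -
      have "\<theta> - v / (1 + v) * y = ((1 + v) * \<theta> - v * y) / (1 + v)"
        by (simp add: diff_divide_distrib)
      then show ?thesis by (simp add: power_divide power2_eq_square)
    qed
    also have "\<dots> = \<theta>\<^sup>2 / (2 * v) + (y - \<theta>)\<^sup>2 / 2 - y\<^sup>2 / (2 * (1 + v))"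
    proof -
      have "\<theta>\<^sup>2 / (2 * v) + (y - \<theta>)\<^sup>2 / 2 - y\<^sup>2 / (2 * (1 + v))
          = (\<theta>\<^sup>2 * (1 + v) + (y - \<theta>)\<^sup>2 * (v * (1 + v)) - y\<^sup>2 * v) / (2 * v * (1 + v))"
      proof -
        have "\<theta>\<^sup>2 / (2 * v) = \<theta>\<^sup>2 * (1 + v) / (2 * v * (1 + v))"
          "y\<^sup>2 / (2 * (1 + v)) = y\<^sup>2 * v / (2 * v * (1 + v))"
          using v by auto
        moreover have "(y - \<theta>)\<^sup>2 / 2 = (y - \<theta>)\<^sup>2 * (v * (1 + v)) / (2 * v * (1 + v))"
          using v nonzero_mult_divide_mult_cancel_right[of "v * (1 + v)" "(y - \<theta>)\<^sup>2" 2]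
          by (simp only: mult.assoc) auto
        ultimately show ?thesis by (simp only: add_divide_distrib diff_divide_distrib)
      qed
      also have "\<theta>\<^sup>2 * (1 + v) + (y - \<theta>)\<^sup>2 * (v * (1 + v)) - y\<^sup>2 * v = ((1 + v) * \<theta> - v * y)\<^sup>2"
        by algebra
      finally show ?thesis ..
    qed
    finally show ?thesis by simp
  qed
  have "normal_density 0 (l * \<tau>) \<theta> * normal_density \<theta> 1 y =
      1 / (sqrt (2 * pi * v) * sqrt (2 * pi)) * exp (- \<theta>\<^sup>2 / (2 * v) - (y - \<theta>)\<^sup>2 / 2)"
    by (simp add: normal_density_def v_def[symmetric] exp_add[symmetric])
  also have "\<dots> = 1 / (sqrt (2 * pi * (1 + v)) * sqrt (2 * pi * (v / (1 + v))))
      * exp (- y\<^sup>2 / (2 * (1 + v)) - (\<theta> - v / (1 + v) * y)\<^sup>2 / (2 * (v / (1 + v))))"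
    unfolding c e ..
  also have "\<dots> = marginal_density \<tau> y l * normal_density (shrinkage \<tau> l * y) (sqrt (shrinkage \<tau> l)) \<theta>"
    using v by (simp add: normal_density_def marginal_density_def v_def[symmetric] s exp_add[symmetric] del: real_sqrt_mult)
  finally show ?thesis .
qed

text \<open>The prior predictive density of one observation, which is the normalising constant in
  Bayes' formula.\<close>

definition evidence :: "real \<Rightarrow> real \<Rightarrow> real" where
  "evidence \<tau> y = (\<integral>\<theta>. normal_density \<theta> 1 y \<partial>horseshoe_coord \<tau>)"

definition coord_mean :: "real \<Rightarrow> real \<Rightarrow> real" where
  "coord_mean \<tau> y = (\<integral>\<theta>. normal_density \<theta> 1 y * \<theta> \<partial>horseshoe_coord \<tau>) / evidence \<tau> y"

lemma normal_density_unit_le: "normal_density \<mu> 1 x \<le> 1"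
proof -
  have "exp (- (x - \<mu>)\<^sup>2 / 2) / sqrt (2 * pi) \<le> 1 / 1"
    using sqrt_2pi_ge_1 by (intro frac_le) auto
  then show ?thesis by (simp add: normal_density_def)
qed

text \<open>Supplies the bound, uniform in \<theta>, with which
  \<open>integral_horseshoe_coord\<close> is applied to the posterior mean. It follows from
  |\<theta>| \<le> |y| + |y - \<theta>| and d \<le> 1 + d^2 / 2 \<le> exp (d^2 / 2).\<close>

lemma normal_density_unit_times_le: "normal_density \<theta> 1 y * \<bar>\<theta>\<bar> \<le> \<bar>y\<bar> + 2"
proof -
  have "1 + (y - \<theta>)\<^sup>2 / 2 \<le> exp ((y - \<theta>)\<^sup>2 / 2)" by (rule exp_ge_add_one_self)
  moreover have "d \<le> 1 + d\<^sup>2 / 2" for d :: real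
    using zero_le_power2[of "d - 1"] by (simp add: power2_diff)
  from this[of "\<bar>y - \<theta>\<bar>"] have "\<bar>y - \<theta>\<bar> \<le> 1 + (y - \<theta>)\<^sup>2 / 2"
    by simp
  ultimately have "\<bar>y - \<theta>\<bar> * exp (- (y - \<theta>)\<^sup>2 / 2) \<le> 1"
    by (simp add: exp_minus field_simps)
  moreover have "exp (- (y - \<theta>)\<^sup>2 / 2) / sqrt (2 * pi) \<le> exp (- (y - \<theta>)\<^sup>2 / 2) / 1"
    using sqrt_2pi_ge_1 by (intro divide_left_mono) auto
  then have "normal_density \<theta> 1 y \<le> exp (- (y - \<theta>)\<^sup>2 / 2)"
    by (simp add: normal_density_def)
  then have "normal_density \<theta> 1 y * \<bar>y - \<theta>\<bar> \<le> exp (- (y - \<theta>)\<^sup>2 / 2) * \<bar>y - \<theta>\<bar>"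
    by (rule mult_right_mono) simp
  moreover have "normal_density \<theta> 1 y * \<bar>\<theta>\<bar> \<le> normal_density \<theta> 1 y * (\<bar>y\<bar> + \<bar>y - \<theta>\<bar>)"
    by (rule mult_left_mono) auto
  moreover have "normal_density \<theta> 1 y * \<bar>y\<bar> \<le> 1 * \<bar>y\<bar>"
    by (rule mult_right_mono[OF normal_density_unit_le]) simp
  ultimately show ?thesis by (simp add: algebra_simps)
qed

lemma evidence_eq:
  assumes "0 < \<tau>"
  shows "evidence \<tau> y = (\<integral>l. marginal_density \<tau> y l \<partial>half_cauchy)"
proof -
  have "evidence \<tau> y = (\<integral>l. (\<integral>\<theta>. normal_density 0 (l * \<tau>) \<theta> * normal_density \<theta> 1 y \<partial>lborel) \<partial>half_cauchy)"
    unfolding evidence_def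
    by (rule integral_horseshoe_coord[of _ 1]) (auto simp: normal_density_unit_le)
  also have "\<dots> = (\<integral>l. marginal_density \<tau> y l \<partial>half_cauchy)"
  proof (rule integral_cong_AE)
    show "AE l in half_cauchy. (\<integral>\<theta>. normal_density 0 (l * \<tau>) \<theta> * normal_density \<theta> 1 y \<partial>lborel) = marginal_density \<tau> y l"
      using AE_half_cauchy_pos
    proof eventually_elim
      case (elim l)
      then have "0 < shrinkage \<tau> l" using assms by (simp add: shrinkage_def)
      then show ?case
        using elim assms by (simp add: normal_density_product)
    qed
  qed measurable
  finally show ?thesis .
qed

lemma coord_mean_eq:
  assumes "0 < \<tau>"
  shows "coord_mean \<tau> y =
    y * (\<integral>l. shrinkage \<tau> l * marginal_density \<tau> y l \<partial>half_cauchy) / evidence \<tau> y"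
proof -
  have "(\<integral>\<theta>. normal_density \<theta> 1 y * \<theta> \<partial>horseshoe_coord \<tau>) =
      (\<integral>l. (\<integral>\<theta>. normal_density 0 (l * \<tau>) \<theta> * (normal_density \<theta> 1 y * \<theta>) \<partial>lborel) \<partial>half_cauchy)"
    by (rule integral_horseshoe_coord[of _ "\<bar>y\<bar> + 2"])
       (auto simp: abs_mult normal_density_unit_times_le)
  also have "\<dots> = (\<integral>l. y * (shrinkage \<tau> l * marginal_density \<tau> y l) \<partial>half_cauchy)"
  proof (rule integral_cong_AE)
    show "AE l in half_cauchy. (\<integral>\<theta>. normal_density 0 (l * \<tau>) \<theta> * (normal_density \<theta> 1 y * \<theta>) \<partial>lborel) =
        y * (shrinkage \<tau> l * marginal_density \<tau> y l)"
      using AE_half_cauchy_pos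
    proof eventually_elim
      case (elim l)
      then have "0 < shrinkage \<tau> l" using assms by (simp add: shrinkage_def)
      then show ?case
        using elim assms
        by (simp add: normal_density_product mult.assoc[symmetric])
           (simp add: mult.assoc integral_normal_moment_nz_1)
    qed
  qed measurable
  also have "\<dots> = y * (\<integral>l. shrinkage \<tau> l * marginal_density \<tau> y l \<partial>half_cauchy)"
    by simp
  finally show ?thesis by (simp add: coord_mean_def)
qed

lemma measurable_evidence: "0 < \<tau> \<Longrightarrow> evidence \<tau> \<in> borel_measurable borel"
  and measurable_coord_mean: "0 < \<tau> \<Longrightarrow> coord_mean \<tau> \<in> borel_measurable borel"
proof -
  assume "0 < \<tau>"
  then interpret prob_space "horseshoe_coord \<tau>" by (rule prob_space_horseshoe_coord)
  show [measurable]: "evidence \<tau> \<in> borel_measurable borel"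
    unfolding evidence_def by measurable
  show "coord_mean \<tau> \<in> borel_measurable borel"
    unfolding coord_mean_def by measurable
qed

subsection \<open>Bounds for the evidence and the posterior mean\<close>

text \<open>Convexity of \<open>exp\<close> between 0 and \<open>a\<close>. The bound is linear in
  \<open>z\<close>, so integrating it requires only the mean of \<open>z\<close>.\<close>

lemma exp_mult_le_chord:
  assumes "0 \<le> z" "z \<le> 1"
  shows "exp (z * a) \<le> 1 - z + z * (exp a :: real)"
proof -
  have "exp ((1 - z) *\<^sub>R 0 + z *\<^sub>R a) \<le> (1 - z) * exp 0 + z * exp a"
    by (rule convex_onD[OF exp_convex]) (use assms in auto)
  then show ?thesis using assms by simp
qed

lemma std_normal_density_eq: "std_normal_density y = exp (- y\<^sup>2 / 2) / sqrt (2 * pi)"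
  by (simp add: std_normal_density_def)

lemma integrable_marginal_density:
  assumes "f \<in> borel_measurable borel" "\<And>l. 0 \<le> f l \<and> f l \<le> 1"
  shows "integrable half_cauchy (\<lambda>l. f l * marginal_density \<tau> y l)"
proof (rule integrable_half_cauchy_bounded[of _ 1])
  show "(\<lambda>l. f l * marginal_density \<tau> y l) \<in> borel_measurable borel"
    using assms(1) by measurable
  fix l
  have "f l * marginal_density \<tau> y l \<le> 1 * 1"
    using assms(2)[of l] marginal_density_le_1 marginal_density_pos[of \<tau> y l, THEN less_imp_le]
    by (intro mult_mono) auto
  then show "\<bar>f l * marginal_density \<tau> y l\<bar> \<le> 1"
    using assms(2)[of l] marginal_density_pos[of \<tau> y l, THEN less_imp_le] by (simp add: abs_mult)
qed

lemma integrable_marginal_density' [simp]: "integrable half_cauchy (marginal_density \<tau> y)"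
  using integrable_marginal_density[of "\<lambda>_. 1"] by simp

lemma integrable_shrinkage_marginal [simp]:
  "integrable half_cauchy (\<lambda>l. shrinkage \<tau> l * marginal_density \<tau> y l)"
  by (rule integrable_marginal_density) (auto simp: shrinkage_bounds less_imp_le)

lemma integrable_shrinkage [simp]: "integrable half_cauchy (shrinkage \<tau>)"
  by (rule integrable_half_cauchy_bounded[of _ 1]) (auto simp: shrinkage_bounds abs_of_nonneg less_imp_le)

lemma integrable_sqrt_shrinkage [simp]: "integrable half_cauchy (\<lambda>l. sqrt (1 - shrinkage \<tau> l))"
  by (rule integrable_half_cauchy_bounded[of _ 1]) (auto simp: shrinkage_bounds abs_of_nonneg less_imp_le)

text \<open>Shrinkage only enlarges the exponential factor of the marginal density, so the standard
  normal density can be pulled out and the square-root factor remains to be integrated.\<close>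

lemma evidence_ge:
  assumes "0 < \<tau>" "\<tau> \<le> 1"
  shows "evidence \<tau> y \<ge> std_normal_density y / 3"
proof -
  have "std_normal_density y * (1 / 3) \<le> std_normal_density y * (\<integral>l. sqrt (1 - shrinkage \<tau> l) \<partial>half_cauchy)"
    by (rule mult_left_mono[OF integral_sqrt_shrinkage_ge[OF assms]]) simp
  also have "\<dots> = (\<integral>l. std_normal_density y * sqrt (1 - shrinkage \<tau> l) \<partial>half_cauchy)"
    by simp
  also have "\<dots> \<le> (\<integral>l. marginal_density \<tau> y l \<partial>half_cauchy)"
  proof (rule integral_mono)
    fix l
    have "- y\<^sup>2 / 2 \<le> - y\<^sup>2 * (1 - shrinkage \<tau> l) / 2"
      using shrinkage_bounds[of \<tau> l] by (simp add: algebra_simps)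
    then have "exp (- y\<^sup>2 / 2) \<le> exp (- y\<^sup>2 * (1 - shrinkage \<tau> l) / 2)" by simp
    then have "exp (- y\<^sup>2 / 2) / sqrt (2 * pi) * sqrt (1 - shrinkage \<tau> l) \<le>
        exp (- y\<^sup>2 * (1 - shrinkage \<tau> l) / 2) / sqrt (2 * pi) * sqrt (1 - shrinkage \<tau> l)"
      using shrinkage_bounds[of \<tau> l] by (intro mult_right_mono divide_right_mono) auto
    then show "std_normal_density y * sqrt (1 - shrinkage \<tau> l) \<le> marginal_density \<tau> y l"
      by (simp add: std_normal_density_eq marginal_density_eq mult_ac)
  qed auto
  finally show ?thesis using assms by (simp add: evidence_eq)
qed

lemma evidence_pos: "0 < \<tau> \<Longrightarrow> \<tau> \<le> 1 \<Longrightarrow> 0 < evidence \<tau> y"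
  using evidence_ge[of \<tau> y] normal_density_pos[of 1 0 y] by linarith

text \<open>The square-root factor is dropped and the exponential is replaced by its chord in the
  shrinkage, whose prior mean is at most \<tau>.\<close>

lemma evidence_le:
  assumes "0 < \<tau>"
  shows "evidence \<tau> y \<le> std_normal_density y * (1 + \<tau> * exp (y\<^sup>2 / 2))"
proof -
  have "evidence \<tau> y = (\<integral>l. marginal_density \<tau> y l \<partial>half_cauchy)"
    using assms by (rule evidence_eq)
  also have "\<dots> \<le> (\<integral>l. std_normal_density y * (1 + shrinkage \<tau> l * exp (y\<^sup>2 / 2)) \<partial>half_cauchy)"
  proof (rule integral_mono)
    fix l
    have "marginal_density \<tau> y l = std_normal_density y * (sqrt (1 - shrinkage \<tau> l) * exp (shrinkage \<tau> l * (y\<^sup>2 / 2)))"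
      unfolding marginal_density_eq std_normal_density_eq
      by (simp add: exp_add[symmetric] algebra_simps diff_divide_distrib)
    also have "\<dots> \<le> std_normal_density y * (1 * (1 + shrinkage \<tau> l * exp (y\<^sup>2 / 2)))"
    proof (intro mult_left_mono mult_mono)
      show "exp (shrinkage \<tau> l * (y\<^sup>2 / 2)) \<le> 1 + shrinkage \<tau> l * exp (y\<^sup>2 / 2)"
        using exp_mult_le_chord[of "shrinkage \<tau> l" "y\<^sup>2 / 2"] shrinkage_bounds[of \<tau> l] by linarith
    qed (use shrinkage_bounds[of \<tau> l] in auto)
    finally show "marginal_density \<tau> y l \<le> std_normal_density y * (1 + shrinkage \<tau> l * exp (y\<^sup>2 / 2))" by simp
  qed auto
  also have "\<dots> = std_normal_density y * (1 + (\<integral>l. shrinkage \<tau> l \<partial>half_cauchy) * exp (y\<^sup>2 / 2))"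
    using half_cauchy.prob_space by simp
  also have "\<dots> \<le> std_normal_density y * (1 + \<tau> * exp (y\<^sup>2 / 2))"
    using integral_shrinkage_le[OF assms] by (intro mult_left_mono add_left_mono mult_right_mono) auto
  finally show ?thesis .
qed

text \<open>The integral is the numerator of the posterior mean of the shrinkage. The first two
  bounds put that mean between 0 and 1; the third, linear in \<tau>, makes it small where the
  evidence is not.\<close>

lemma integral_shrinkage_marginal_bounds:
  assumes "0 < \<tau>"
  shows "0 \<le> (\<integral>l. shrinkage \<tau> l * marginal_density \<tau> y l \<partial>half_cauchy)"
    and "(\<integral>l. shrinkage \<tau> l * marginal_density \<tau> y l \<partial>half_cauchy) \<le> evidence \<tau> y"
    and "(\<integral>l. shrinkage \<tau> l * marginal_density \<tau> y l \<partial>half_cauchy) \<le> \<tau> / sqrt (2 * pi)"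
proof -
  have g: "0 \<le> marginal_density \<tau> y l" for l using marginal_density_pos[of \<tau> y l] by simp
  show "0 \<le> (\<integral>l. shrinkage \<tau> l * marginal_density \<tau> y l \<partial>half_cauchy)"
    using g shrinkage_bounds by (intro integral_nonneg_AE) auto
  show "(\<integral>l. shrinkage \<tau> l * marginal_density \<tau> y l \<partial>half_cauchy) \<le> evidence \<tau> y"
    unfolding evidence_eq[OF assms]
    by (rule integral_mono) (auto intro!: mult_left_le_one_le g simp: shrinkage_bounds less_imp_le)
  have "(\<integral>l. shrinkage \<tau> l * marginal_density \<tau> y l \<partial>half_cauchy) \<le> (\<integral>l. shrinkage \<tau> l * (1 / sqrt (2 * pi)) \<partial>half_cauchy)"
  proof (rule integral_mono)
    fix l
    have "sqrt (1 - shrinkage \<tau> l) * exp (- y\<^sup>2 * (1 - shrinkage \<tau> l) / 2) / sqrt (2 * pi) \<le> 1 * 1 / sqrt (2 * pi)"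
      using shrinkage_bounds[of \<tau> l] by (intro divide_right_mono mult_mono) auto
    then show "shrinkage \<tau> l * marginal_density \<tau> y l \<le> shrinkage \<tau> l * (1 / sqrt (2 * pi))"
      unfolding marginal_density_eq by (intro mult_left_mono) (auto simp: shrinkage_bounds)
  qed auto
  also have "\<dots> \<le> \<tau> * (1 / sqrt (2 * pi))"
    using integral_shrinkage_le[OF assms] by (simp add: divide_right_mono)
  finally show "(\<integral>l. shrinkage \<tau> l * marginal_density \<tau> y l \<partial>half_cauchy) \<le> \<tau> / sqrt (2 * pi)" by simp
qed

text \<open>The second bound divides the numerator bound of order \<tau> by the lower bound
  \<open>evidence_ge\<close>. It is the useful one as long as
  \<open>\<tau> * exp (y\<^sup>2 / 2)\<close> is small, that is, well below the threshold.\<close>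

lemma coord_mean_abs_le:
  assumes "0 < \<tau>" "\<tau> \<le> 1"
  shows "\<bar>coord_mean \<tau> y\<bar> \<le> \<bar>y\<bar>" "\<bar>coord_mean \<tau> y\<bar> \<le> 3 * \<bar>y\<bar> * (\<tau> * exp (y\<^sup>2 / 2))"
proof -
  let ?I = "\<integral>l. shrinkage \<tau> l * marginal_density \<tau> y l \<partial>half_cauchy"
  note b = integral_shrinkage_marginal_bounds[OF assms(1), of y]
  have Z: "0 < evidence \<tau> y" using assms by (rule evidence_pos)
  have m: "\<bar>coord_mean \<tau> y\<bar> = \<bar>y\<bar> * (?I / evidence \<tau> y)"
    using Z b(1) by (simp add: coord_mean_eq[OF assms(1)] abs_mult)
  have "?I / evidence \<tau> y \<le> 1" using Z b(2) by simp
  from mult_left_mono[OF this, of "\<bar>y\<bar>"] show "\<bar>coord_mean \<tau> y\<bar> \<le> \<bar>y\<bar>"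
    unfolding m by simp
  have "?I / evidence \<tau> y \<le> (\<tau> / sqrt (2 * pi)) / (std_normal_density y / 3)"
    using b evidence_ge[OF assms, of y] assms by (intro frac_le) (auto simp: normal_density_pos)
  also have "\<dots> = 3 * (\<tau> * exp (y\<^sup>2 / 2))"
  proof -
    have "t / s / (1 / e / s / 3) = 3 * (t * e)" if "0 < s" "0 < e" for s t e :: real
      using that by simp
    from this[of "sqrt (2 * pi)" "exp (y\<^sup>2 / 2)" \<tau>] show ?thesis
      by (simp only: std_normal_density_eq minus_divide_left[symmetric] exp_minus inverse_eq_divide) simp
  qed
  finally have "?I / evidence \<tau> y \<le> 3 * (\<tau> * exp (y\<^sup>2 / 2))" .
  from mult_left_mono[OF this, of "\<bar>y\<bar>"]
  show "\<bar>coord_mean \<tau> y\<bar> \<le> 3 * \<bar>y\<bar> * (\<tau> * exp (y\<^sup>2 / 2))"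
    unfolding m by (simp add: mult_ac)
qed

lemma exp_minus_half_ge: "1 / 2 \<le> exp (- 1 / 2 :: real)"
  using exp_ge_add_one_self[of "- 1 / 2 :: real"] by simp

text \<open>The scales \<open>l\<close> between \<open>\<bar>y\<bar> / \<tau>\<close> and \<open>2 \<bar>y\<bar> / \<tau>\<close> alone give this polynomial lower bound.\<close>

lemma evidence_ge_tail:
  assumes "0 < \<tau>" "\<tau> \<le> 1" "1 \<le> \<bar>y\<bar>"
  shows "evidence \<tau> y \<ge> \<tau> / (96 * y\<^sup>2)"
proof -
  define A where "A = \<bar>y\<bar> / \<tau>"
  have A: "1 \<le> A" using assms by (simp add: A_def divide_simps)
  have "\<tau> / (96 * y\<^sup>2) = 1 / (12 * \<bar>y\<bar>) * (1 / (8 * A))"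
  proof -
    have "\<tau> / (96 * Y\<^sup>2) = 1 / (12 * Y) * (1 / (8 * (Y / \<tau>)))" for Y
      by (simp add: power2_eq_square)
    from this[of "\<bar>y\<bar>"] show ?thesis by (simp add: A_def)
  qed
  also have "\<dots> \<le> 1 / (12 * \<bar>y\<bar>) * measure half_cauchy {A..2 * A}"
    by (rule mult_left_mono[OF half_cauchy_Icc[OF A]]) simp
  also have "\<dots> = (\<integral>l. 1 / (12 * \<bar>y\<bar>) * indicator {A..2 * A} l \<partial>half_cauchy)"
    by simp
  also have "\<dots> \<le> (\<integral>l. marginal_density \<tau> y l \<partial>half_cauchy)"
  proof (rule integral_mono)
    fix l :: real
    \<comment> \<open>Here \<open>l * \<tau>\<close> lies between |y| and 2 |y|, so the marginal
      variance v lies between y^2 and 5 y^2. The exponent is then at least -1/2, and 2 pi v \<le> 35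
      y^2 \<le> (6 |y|)^2.\<close>
    have "1 / (12 * \<bar>y\<bar>) \<le> marginal_density \<tau> y l" if l: "A \<le> l" "l \<le> 2 * A"
    proof -
      define v where "v = 1 + (l * \<tau>)\<^sup>2"
      have "\<bar>y\<bar> \<le> l * \<tau>" "l * \<tau> \<le> 2 * \<bar>y\<bar>"
        using l assms by (auto simp: A_def divide_simps mult_ac)
      then have "\<bar>y\<bar>\<^sup>2 \<le> (l * \<tau>)\<^sup>2" "(l * \<tau>)\<^sup>2 \<le> (2 * \<bar>y\<bar>)\<^sup>2"
        by - (rule power_mono; simp)+
      moreover have "1 \<le> \<bar>y\<bar>\<^sup>2" using one_le_power[OF assms(3), of 2] .
      ultimately have v: "y\<^sup>2 \<le> v" "v \<le> 5 * y\<^sup>2" "1 \<le> v"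
        by (auto simp: v_def power_mult_distrib)
      have "2 * pi * v \<le> 7 * (5 * y\<^sup>2)"
        using v pi_approx by (intro mult_mono) auto
      also have "\<dots> \<le> (6 * \<bar>y\<bar>)\<^sup>2" by (simp add: power_mult_distrib)
      finally have "sqrt (2 * pi * v) \<le> 6 * \<bar>y\<bar>" by (intro real_le_lsqrt) auto
      moreover have "1 / 2 \<le> exp (- y\<^sup>2 / (2 * v))"
      proof -
        have "- 1 / 2 \<le> - y\<^sup>2 / (2 * v)" using v by (simp add: divide_simps)
        then have "exp (- 1 / 2) \<le> exp (- y\<^sup>2 / (2 * v))" by simp
        with exp_minus_half_ge show ?thesis by linarith
      qed
      ultimately have "(1 / 2) / (6 * \<bar>y\<bar>) \<le> exp (- y\<^sup>2 / (2 * v)) / sqrt (2 * pi * v)"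
        using v by (intro frac_le) auto
      then show ?thesis
        using v by (simp add: marginal_density_def normal_density_def v_def[symmetric] del: real_sqrt_mult)
    qed
    then show "1 / (12 * \<bar>y\<bar>) * indicator {A..2 * A} l \<le> marginal_density \<tau> y l"
      using marginal_density_pos[of \<tau> y l] by (auto split: split_indicator)
    show "integrable half_cauchy (\<lambda>l. 1 / (12 * \<bar>y\<bar>) * indicator {A..2 * A} l)"
      by (intro integrable_mult_right integrable_half_cauchy_bounded[of _ 1]) (auto split: split_indicator)
  qed auto
  finally show ?thesis using assms by (simp add: evidence_eq)
qed

text \<open>The level of |y| at which the prior weight \<tau> of a large scale is offset by the
  likelihood gain \<open>exp (y\<^sup>2 / 2)\<close>.\<close>

definition horseshoe_threshold :: "real \<Rightarrow> real" where
  "horseshoe_threshold \<tau> = sqrt (2 * ln (1 / \<tau>))"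

lemma exp_horseshoe_threshold:
  assumes "0 < \<tau>" "\<tau> \<le> 1"
  shows "exp ((horseshoe_threshold \<tau>)\<^sup>2 / 2) = 1 / \<tau>"
  using assms by (simp add: horseshoe_threshold_def)

text \<open>Up to the threshold, shrinking towards 0 moves \<open>y\<close> by at most |y|. Beyond
  it, scales that shrink little move \<open>y\<close> little, and those that shrink much have
  exponentially small marginal density, whereas the evidence decays only polynomially by
  \<open>evidence_ge_tail\<close>.\<close>

lemma coord_mean_minus_data_le:
  assumes \<tau>: "0 < \<tau>" "\<tau> \<le> 1" and \<zeta>: "2 \<le> horseshoe_threshold \<tau>"
  shows "\<bar>y - coord_mean \<tau> y\<bar> \<le> 52 * horseshoe_threshold \<tau>"
proof -
  define \<zeta> where "\<zeta> = horseshoe_threshold \<tau>"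
  let ?s = "shrinkage \<tau>" and ?g = "marginal_density \<tau> y"
  let ?I = "\<integral>l. (1 - ?s l) * ?g l \<partial>half_cauchy"
  have g: "0 \<le> ?g l" for l using marginal_density_pos[of \<tau> y l] by simp
  have Z: "0 < evidence \<tau> y" using \<tau> by (rule evidence_pos)
  have I: "?I = evidence \<tau> y - (\<integral>l. ?s l * ?g l \<partial>half_cauchy)"
    by (simp add: left_diff_distrib evidence_eq[OF \<tau>(1)])
  have I0: "0 \<le> ?I" using integral_shrinkage_marginal_bounds[OF \<tau>(1), of y] I by simp
  have "y - coord_mean \<tau> y = y * (?I / evidence \<tau> y)"
    unfolding coord_mean_eq[OF \<tau>(1)] I using Z by (simp add: field_simps)
  then have eq: "\<bar>y - coord_mean \<tau> y\<bar> = \<bar>y\<bar> * (?I / evidence \<tau> y)"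
    using I0 Z by (simp add: abs_mult)
  show ?thesis
  proof (cases "\<bar>y\<bar> \<le> \<zeta>")
    case True
    have "?I / evidence \<tau> y \<le> 1"
      using Z I integral_shrinkage_marginal_bounds[OF \<tau>(1), of y] by simp
    from mult_left_mono[OF this, of "\<bar>y\<bar>"] True \<zeta> show ?thesis
      unfolding eq \<zeta>_def by simp
  next
    case False
    then have y: "\<zeta> < \<bar>y\<bar>" "2 \<le> \<bar>y\<bar>" using \<zeta> by (auto simp: \<zeta>_def)
    \<comment> \<open>The cutoff for one minus the shrinkage: scales below it contribute |y| a = 4
      \<zeta> to the difference, and all others have marginal density at most
      \<open>e\<close>.\<close>
    define a where "a = 4 * \<zeta> / \<bar>y\<bar>"
    define e where "e = exp (- (y\<^sup>2 * a / 2))"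
    have "?I \<le> (\<integral>l. a * ?g l + e \<partial>half_cauchy)"
    proof (rule integral_mono)
      show "integrable half_cauchy (\<lambda>l. (1 - ?s l) * ?g l)"
        by (rule integrable_marginal_density) (auto simp: shrinkage_bounds less_imp_le)
      fix l
      show "(1 - ?s l) * ?g l \<le> a * ?g l + e"
      proof (cases "1 - ?s l \<le> a")
        case True
        from mult_right_mono[OF this g[of l]] show ?thesis by (simp add: e_def add_increasing2)
      next
        case False
        have "?g l \<le> 1 * exp (- y\<^sup>2 * (1 - ?s l) / 2) / 1"
          unfolding marginal_density_eq using sqrt_2pi_ge_1 shrinkage_bounds[of \<tau> l]
          by (intro frac_le mult_mono) auto
        also have "\<dots> \<le> e"
          using mult_left_mono[of a "1 - ?s l" "y\<^sup>2"] False by (simp add: e_def)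
        finally have "?g l \<le> e" .
        moreover have "(1 - ?s l) * ?g l \<le> 1 * ?g l"
          using shrinkage_bounds[of \<tau> l] g by (intro mult_right_mono) auto
        moreover have "0 \<le> a * ?g l" using g \<zeta> by (simp add: a_def \<zeta>_def)
        ultimately show ?thesis by linarith
      qed
    qed auto
    also have "\<dots> = a * evidence \<tau> y + e"
      using half_cauchy.prob_space by (simp add: evidence_eq[OF \<tau>(1)])
    finally have "?I / evidence \<tau> y \<le> a + e / evidence \<tau> y"
      using divide_right_mono[of ?I "a * evidence \<tau> y + e" "evidence \<tau> y"] Z
      by (simp only: add_divide_distrib) simp
    also have "e / evidence \<tau> y \<le> e / (\<tau> / (96 * y\<^sup>2))"
      using evidence_ge_tail[OF \<tau>, of y] y \<tau> Z by (intro divide_left_mono) (auto simp: e_def)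
    finally have "?I / evidence \<tau> y \<le> a + e * 96 * y\<^sup>2 / \<tau>" by simp
    from mult_left_mono[OF this, of "\<bar>y\<bar>"]
    have "\<bar>y - coord_mean \<tau> y\<bar> \<le> \<bar>y\<bar> * a + 96 * (\<bar>y\<bar> ^ 3 * e / \<tau>)"
      unfolding eq by (simp add: algebra_simps power3_eq_cube power2_eq_square abs_mult[symmetric])
    also have "\<bar>y\<bar> * a = 4 * \<zeta>" using y by (simp add: a_def)
    \<comment> \<open>The exponent 2 \<zeta> |y| is split as \<zeta> |y| / 2 + 3 \<zeta> |y| / 2,
      which is at least \<zeta>^2 / 2 + 3 |y|. The first part yields a factor \<tau> that cancels
      the division; the second absorbs the cube of |y|.\<close>
    also have "\<bar>y\<bar> ^ 3 * e / \<tau> \<le> 1"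
    proof -
      have "y\<^sup>2 * a / 2 = 2 * \<zeta> * \<bar>y\<bar>"
      proof -
        have "Y\<^sup>2 * (4 * \<zeta> / Y) / 2 = 2 * \<zeta> * Y" if "0 < Y" for Y
          using that by (simp add: power2_eq_square)
        from this[of "\<bar>y\<bar>"] y show ?thesis by (simp add: a_def)
      qed
      moreover have "\<zeta> * \<zeta> \<le> \<zeta> * \<bar>y\<bar>" "2 * \<bar>y\<bar> \<le> \<zeta> * \<bar>y\<bar>"
        using y \<zeta> by (auto simp: \<zeta>_def intro!: mult_left_mono mult_right_mono)
      ultimately have "- (y\<^sup>2 * a / 2) \<le> - (\<zeta>\<^sup>2 / 2) + - (3 * \<bar>y\<bar>)"
        by (simp add: power2_eq_square)
      then have "e \<le> exp (- (\<zeta>\<^sup>2 / 2) + - (3 * \<bar>y\<bar>))" by (simp add: e_def)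
      also have "\<dots> = \<tau> * exp (- \<bar>y\<bar>) ^ 3"
        using exp_horseshoe_threshold[OF \<tau>]
        by (simp only: exp_add exp_minus \<zeta>_def exp_of_nat_mult[symmetric] power_inverse) simp
      finally have "\<bar>y\<bar> ^ 3 * e / \<tau> \<le> \<bar>y\<bar> ^ 3 * (\<tau> * exp (- \<bar>y\<bar>) ^ 3) / \<tau>"
        using \<tau> by (intro divide_right_mono mult_left_mono) auto
      also have "\<dots> = (\<bar>y\<bar> * exp (- \<bar>y\<bar>)) ^ 3" using \<tau> by (simp add: power_mult_distrib)
      also have "\<dots> \<le> 1"
      proof (rule power_le_one)
        have "\<bar>y\<bar> \<le> exp \<bar>y\<bar>" using exp_ge_add_one_self[of "\<bar>y\<bar>"] by linarith
        then show "\<bar>y\<bar> * exp (- \<bar>y\<bar>) \<le> 1" by (simp add: exp_minus field_simps)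
      qed simp
      finally show ?thesis .
    qed
    \<comment> \<open>Since \<zeta> \<ge> 2, the bound 4 \<zeta> + 96 is at most (4 + 48)
      \<zeta>.\<close>
    finally show ?thesis using \<zeta> by (simp add: \<zeta>_def)
  qed
qed

subsection \<open>Risk and truncated posterior variance of one coordinate\<close>

lemma std_normal_density_threshold:
  assumes "0 < \<tau>" "\<tau> \<le> 1"
  shows "std_normal_density (horseshoe_threshold \<tau>) = \<tau> / sqrt (2 * pi)"
  using exp_horseshoe_threshold[OF assms] by (simp add: std_normal_density_eq exp_minus)

text \<open>For y \<ge> 2 the factor y^2 is at most 2 (y^2 - 1), and the enlarged integrand has the
  antiderivative \<open>- 2 * y * std_normal_density y\<close>.\<close>

lemma nn_integral_normal_tail:
  assumes "2 \<le> a"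
  shows "(\<integral>\<^sup>+y. ennreal (std_normal_density y * y\<^sup>2) * indicator {a..} y \<partial>lborel)
    \<le> ennreal (2 * a * std_normal_density a)"
proof -
  have pos: "0 \<le> 2 * (y\<^sup>2 - 1)" if "a \<le> y" for y
    using that assms power_mono[of 2 y 2] by auto
  have "(\<integral>\<^sup>+y. ennreal (std_normal_density y * y\<^sup>2) * indicator {a..} y \<partial>lborel)
      \<le> (\<integral>\<^sup>+y. ennreal (2 * (y\<^sup>2 - 1) * std_normal_density y) * indicator {a..} y \<partial>lborel)"
  proof (rule nn_integral_mono)
    fix y
    have "std_normal_density y * y\<^sup>2 \<le> std_normal_density y * (2 * (y\<^sup>2 - 1))" if "a \<le> y"
      using that assms power_mono[of 2 y 2] by (intro mult_left_mono) auto
    then show "ennreal (std_normal_density y * y\<^sup>2) * indicator {a..} y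
        \<le> ennreal (2 * (y\<^sup>2 - 1) * std_normal_density y) * indicator {a..} y"
      by (auto split: split_indicator intro!: ennreal_leI simp: mult.commute)
  qed
  also have "\<dots> = ennreal (0 - (- 2 * a * std_normal_density a))"
  proof (rule nn_integral_FTC_atLeast)
    show "((\<lambda>y. - 2 * y * std_normal_density y) has_real_derivative 2 * (y\<^sup>2 - 1) * std_normal_density y) (at y)" for y
    proof -
      have "((\<lambda>y. exp (- y\<^sup>2 / 2) / c) has_real_derivative - y * (exp (- y\<^sup>2 / 2) / c)) (at y)" if "c \<noteq> 0" for c :: real
        using that by (auto intro!: derivative_eq_intros)
      then have [derivative_intros]: "(std_normal_density has_real_derivative - y * std_normal_density y) (at y)"
        unfolding std_normal_density_eq by simp
      show ?thesis
        by (auto intro!: derivative_eq_intros simp: algebra_simps power2_eq_square)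
    qed
    show "0 \<le> 2 * (y\<^sup>2 - 1) * std_normal_density y" if "a \<le> y" for y
      using pos[OF that] by simp
    show "((\<lambda>y. - 2 * y * std_normal_density y) \<longlongrightarrow> 0) at_top"
      unfolding std_normal_density_eq by real_asymp
  qed measurable
  finally show ?thesis by simp
qed

lemma nn_integral_normal_tail_left:
  assumes "2 \<le> a"
  shows "(\<integral>\<^sup>+y. ennreal (std_normal_density y * y\<^sup>2) * indicator {..-a} y \<partial>lborel)
    \<le> ennreal (2 * a * std_normal_density a)"
proof -
  have "(\<integral>\<^sup>+y. ennreal (std_normal_density y * y\<^sup>2) * indicator {..-a} y \<partial>lborel) =
      (\<integral>\<^sup>+y. ennreal (std_normal_density y * y\<^sup>2) * indicator {a..} y \<partial>lborel)"
    by (subst nn_integral_real_affine[of _ "-1" 0])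
       (auto intro!: nn_integral_cong simp: std_normal_density_eq split: split_indicator)
  with nn_integral_normal_tail[OF assms] show ?thesis by simp
qed

text \<open>Enlarging y^2 to 1 + y^2 makes \<open>y * exp (y\<^sup>2 / 2)\<close> an
  antiderivative.\<close>

lemma nn_integral_bulk:
  assumes "0 \<le> a"
  shows "(\<integral>\<^sup>+y. ennreal (y\<^sup>2 * exp (y\<^sup>2 / 2)) * indicator {-a..a} y \<partial>lborel) \<le> ennreal (2 * a * exp (a\<^sup>2 / 2))"
proof -
  have "(\<integral>\<^sup>+y. ennreal (y\<^sup>2 * exp (y\<^sup>2 / 2)) * indicator {-a..a} y \<partial>lborel)
      \<le> (\<integral>\<^sup>+y. ennreal ((1 + y\<^sup>2) * exp (y\<^sup>2 / 2)) * indicator {-a..a} y \<partial>lborel)"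
    by (intro nn_integral_mono mult_right_mono ennreal_leI) auto
  also have "\<dots> = ennreal (a * exp (a\<^sup>2 / 2) - (- a) * exp ((- a)\<^sup>2 / 2))"
  proof (rule nn_integral_FTC_Icc)
    show "((\<lambda>y. y * exp (y\<^sup>2 / 2)) has_real_derivative (1 + y\<^sup>2) * exp (y\<^sup>2 / 2)) (at y)" for y :: real
      by (auto intro!: derivative_eq_intros simp: algebra_simps power2_eq_square)
  qed (use assms in auto)
  finally show ?thesis by (simp add: mult.assoc)
qed

text \<open>The integral is split at plus and minus the threshold. Inside, the second bound of
  \<open>coord_mean_abs_le\<close> squared leaves 9 \<tau>^2 y^2 exp (y^2 / 2), which integrates to
  at most 18 \<tau> \<zeta>; outside, |y| bounds the mean and the two tails give at most 4 \<tau>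
  \<zeta>.\<close>

lemma risk_at_zero:
  assumes \<tau>: "0 < \<tau>" "\<tau> \<le> 1" and \<zeta>: "2 \<le> horseshoe_threshold \<tau>"
  shows "(\<integral>\<^sup>+y. ennreal ((coord_mean \<tau> y)\<^sup>2) \<partial>density lborel std_normal_density)
    \<le> ennreal (22 * (\<tau> * horseshoe_threshold \<tau>))"
proof -
  define \<zeta> where "\<zeta> = horseshoe_threshold \<tau>"
  have \<zeta>2: "2 \<le> \<zeta>" using \<zeta> by (simp add: \<zeta>_def)
  have [measurable]: "coord_mean \<tau> \<in> borel_measurable borel" using \<tau> by (intro measurable_coord_mean)
  let ?h = "\<lambda>y. ennreal (std_normal_density y * y\<^sup>2)"
  have "(\<integral>\<^sup>+y. ennreal ((coord_mean \<tau> y)\<^sup>2) \<partial>density lborel std_normal_density)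
      = (\<integral>\<^sup>+y. ennreal (std_normal_density y) * ennreal ((coord_mean \<tau> y)\<^sup>2) \<partial>lborel)"
    by (rule nn_integral_density) auto
  also have "\<dots> \<le> (\<integral>\<^sup>+y. ennreal (9 * \<tau>\<^sup>2) * (ennreal (y\<^sup>2 * exp (y\<^sup>2 / 2)) * indicator {-\<zeta>..\<zeta>} y)
      + (?h y * indicator {\<zeta>..} y + ?h y * indicator {..-\<zeta>} y) \<partial>lborel)"
  proof (rule nn_integral_mono)
    fix y :: real
    have tail: "std_normal_density y * (coord_mean \<tau> y)\<^sup>2 \<le> std_normal_density y * y\<^sup>2"
      using power_mono[OF coord_mean_abs_le(1)[OF \<tau>, of y], of 2] by (intro mult_left_mono) auto
    have "(coord_mean \<tau> y)\<^sup>2 \<le> (3 * \<bar>y\<bar> * (\<tau> * exp (y\<^sup>2 / 2)))\<^sup>2"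
      using power_mono[OF coord_mean_abs_le(2)[OF \<tau>, of y], of 2] by simp
    also have "\<dots> = 9 * \<tau>\<^sup>2 * (y\<^sup>2 * exp (y\<^sup>2 / 2)) * exp (y\<^sup>2 / 2)"
      by (simp add: power_mult_distrib power2_eq_square[of "exp _"])
    finally have "std_normal_density y * (coord_mean \<tau> y)\<^sup>2 \<le>
        (exp (- y\<^sup>2 / 2) / 1) * (9 * \<tau>\<^sup>2 * (y\<^sup>2 * exp (y\<^sup>2 / 2)) * exp (y\<^sup>2 / 2))"
      unfolding std_normal_density_eq using sqrt_2pi_ge_1
      by (intro mult_mono divide_left_mono) auto
    also have "\<dots> = 9 * \<tau>\<^sup>2 * (y\<^sup>2 * exp (y\<^sup>2 / 2))" by (simp add: exp_minus)
    finally have bulk: "std_normal_density y * (coord_mean \<tau> y)\<^sup>2 \<le> 9 * \<tau>\<^sup>2 * (y\<^sup>2 * exp (y\<^sup>2 / 2))" .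
    consider "- \<zeta> \<le> y \<and> y \<le> \<zeta>" | "\<zeta> < y" | "y < - \<zeta>" by linarith
    then show "ennreal (std_normal_density y) * ennreal ((coord_mean \<tau> y)\<^sup>2)
        \<le> ennreal (9 * \<tau>\<^sup>2) * (ennreal (y\<^sup>2 * exp (y\<^sup>2 / 2)) * indicator {-\<zeta>..\<zeta>} y)
          + (?h y * indicator {\<zeta>..} y + ?h y * indicator {..-\<zeta>} y)"
    proof cases
      case 1
      then show ?thesis using ennreal_leI[OF bulk]
        by (intro add_increasing2) (auto simp: ennreal_mult[symmetric])
    next
      case 2
      then show ?thesis using ennreal_leI[OF tail] \<zeta>2 by (simp add: ennreal_mult[symmetric])
    next
      case 3
      then show ?thesis using ennreal_leI[OF tail] \<zeta>2 by (simp add: ennreal_mult[symmetric])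
    qed
  qed
  also have "\<dots> = ennreal (9 * \<tau>\<^sup>2) * (\<integral>\<^sup>+y. ennreal (y\<^sup>2 * exp (y\<^sup>2 / 2)) * indicator {-\<zeta>..\<zeta>} y \<partial>lborel)
      + ((\<integral>\<^sup>+y. ?h y * indicator {\<zeta>..} y \<partial>lborel) + (\<integral>\<^sup>+y. ?h y * indicator {..-\<zeta>} y \<partial>lborel))"
    by (simp add: nn_integral_add nn_integral_cmult)
  also have "\<dots> \<le> ennreal (9 * \<tau>\<^sup>2) * ennreal (2 * \<zeta> * exp (\<zeta>\<^sup>2 / 2))
      + (ennreal (2 * \<zeta> * std_normal_density \<zeta>) + ennreal (2 * \<zeta> * std_normal_density \<zeta>))"
    using \<zeta>2 by (intro add_mono mult_left_mono nn_integral_bulk nn_integral_normal_tail nn_integral_normal_tail_left) auto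
  also have "\<dots> = ennreal (9 * \<tau>\<^sup>2 * (2 * \<zeta> * (1 / \<tau>)) + 4 * \<zeta> * (\<tau> / sqrt (2 * pi)))"
    using \<zeta>2 \<tau> by (simp add: \<zeta>_def exp_horseshoe_threshold std_normal_density_threshold
      ennreal_mult[symmetric] ennreal_plus[symmetric] del: ennreal_plus)
  also have "\<dots> \<le> ennreal (22 * (\<tau> * \<zeta>))"
  proof (rule ennreal_leI)
    have "\<tau> / sqrt (2 * pi) \<le> \<tau> / 1" using sqrt_2pi_ge_1 \<tau> by (intro divide_left_mono) auto
    then have "4 * \<zeta> * (\<tau> / sqrt (2 * pi)) \<le> 4 * \<zeta> * \<tau>" using \<zeta>2 by (intro mult_left_mono) auto
    moreover have "9 * \<tau>\<^sup>2 * (2 * \<zeta> * (1 / \<tau>)) = 18 * \<tau> * \<zeta>" using \<tau> by (simp add: power2_eq_square)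
    ultimately show "9 * \<tau>\<^sup>2 * (2 * \<zeta> * (1 / \<tau>)) + 4 * \<zeta> * (\<tau> / sqrt (2 * pi)) \<le> 22 * (\<tau> * \<zeta>)"
      by (simp add: mult_ac)
  qed
  finally show ?thesis by (simp add: \<zeta>_def)
qed

lemma nn_integral_normal_variance:
  "(\<integral>\<^sup>+y. ennreal ((y - \<theta>)\<^sup>2) \<partial>density lborel (normal_density \<theta> 1)) = 1"
proof -
  have "(\<integral>\<^sup>+y. ennreal ((y - \<theta>)\<^sup>2) \<partial>density lborel (normal_density \<theta> 1)) =
      (\<integral>\<^sup>+y. ennreal (normal_density \<theta> 1 y * (y - \<theta>) ^ (2 * 1)) \<partial>lborel)"
    by (subst nn_integral_density) (auto simp: ennreal_mult)
  also have "\<dots> = ennreal 1"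
    using normal_moment_even[of 1 \<theta> 1]
    by (intro nn_integral_eq_integral[THEN trans]) (auto simp: has_bochner_integral_iff)
  finally show ?thesis by simp
qed

text \<open>The error is split into the distance from posterior mean to data and the noise. The
  former contributes 2 * 52^2 = 5408 times \<zeta>^2, the latter 2 \<le> \<zeta>^2.\<close>

lemma risk_le:
  assumes \<tau>: "0 < \<tau>" "\<tau> \<le> 1" and \<zeta>: "2 \<le> horseshoe_threshold \<tau>"
  shows "(\<integral>\<^sup>+y. ennreal ((\<theta> - coord_mean \<tau> y)\<^sup>2) \<partial>density lborel (normal_density \<theta> 1))
    \<le> ennreal (5409 * (horseshoe_threshold \<tau>)\<^sup>2)"
proof -
  let ?N = "density lborel (normal_density \<theta> 1)"
  define \<zeta> where "\<zeta> = horseshoe_threshold \<tau>"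
  interpret prob_space ?N by (rule prob_space_normal_density) simp
  have [measurable]: "coord_mean \<tau> \<in> borel_measurable borel" using \<tau> by (intro measurable_coord_mean)
  have "(\<integral>\<^sup>+y. ennreal ((\<theta> - coord_mean \<tau> y)\<^sup>2) \<partial>?N)
      \<le> (\<integral>\<^sup>+y. ennreal (5408 * \<zeta>\<^sup>2) + ennreal 2 * ennreal ((y - \<theta>)\<^sup>2) \<partial>?N)"
  proof (rule nn_integral_mono)
    fix y
    have "(y - coord_mean \<tau> y)\<^sup>2 \<le> (52 * \<zeta>)\<^sup>2"
      using power_mono[OF coord_mean_minus_data_le[OF \<tau> \<zeta>, of y], of 2] by (simp add: \<zeta>_def)
    moreover have "(\<theta> - coord_mean \<tau> y)\<^sup>2 \<le> 2 * (y - coord_mean \<tau> y)\<^sup>2 + 2 * (y - \<theta>)\<^sup>2"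
      using zero_le_power2[of "(y - coord_mean \<tau> y) + (y - \<theta>)"] by (simp add: power2_eq_square algebra_simps)
    ultimately have "(\<theta> - coord_mean \<tau> y)\<^sup>2 \<le> 5408 * \<zeta>\<^sup>2 + 2 * (y - \<theta>)\<^sup>2"
      by (simp add: power_mult_distrib)
    from ennreal_leI[OF this] show "ennreal ((\<theta> - coord_mean \<tau> y)\<^sup>2) \<le> ennreal (5408 * \<zeta>\<^sup>2) + ennreal 2 * ennreal ((y - \<theta>)\<^sup>2)"
      by (simp add: ennreal_mult[symmetric] ennreal_plus[symmetric] del: ennreal_plus ennreal_numeral)
  qed
  also have "\<dots> = ennreal (5408 * \<zeta>\<^sup>2) + ennreal 2"
    using emeasure_space_1
    by (simp add: nn_integral_add nn_integral_cmult nn_integral_normal_variance)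
  also have "\<dots> \<le> ennreal (5409 * \<zeta>\<^sup>2)"
    using \<zeta> power_mono[of 2 \<zeta> 2]
    by (simp add: \<zeta>_def ennreal_plus[symmetric] del: ennreal_plus ennreal_numeral)
  finally show ?thesis by (simp add: \<zeta>_def)
qed

section \<open>Prior mass near and far from zero, and the truncated posterior variance\<close>

definition coord_posterior :: "real \<Rightarrow> real \<Rightarrow> real measure" where
  "coord_posterior \<tau> y = density (horseshoe_coord \<tau>) (\<lambda>\<theta>. ennreal (normal_density \<theta> 1 y / evidence \<tau> y))"

lemma sets_coord_posterior [simp, measurable_cong]: "sets (coord_posterior \<tau> y) = sets borel"
  by (simp add: coord_posterior_def)

lemma space_coord_posterior [simp]: "space (coord_posterior \<tau> y) = UNIV"
  by (simp add: coord_posterior_def)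

lemma integrable_normal_density_horseshoe:
  assumes "0 < \<tau>"
  shows "integrable (horseshoe_coord \<tau>) (\<lambda>\<theta>. normal_density \<theta> 1 y)"
proof -
  interpret prob_space "horseshoe_coord \<tau>" using assms by (rule prob_space_horseshoe_coord)
  show ?thesis
    by (rule integrable_const_bound[of _ 1]) (auto simp: normal_density_unit_le)
qed

lemma prob_space_coord_posterior:
  assumes "0 < \<tau>" "\<tau> \<le> 1"
  shows "prob_space (coord_posterior \<tau> y)"
proof
  have Z: "0 < evidence \<tau> y" using assms by (rule evidence_pos)
  have "emeasure (coord_posterior \<tau> y) UNIV = (\<integral>\<^sup>+\<theta>. ennreal (normal_density \<theta> 1 y / evidence \<tau> y) \<partial>horseshoe_coord \<tau>)"
    unfolding coord_posterior_def by (subst emeasure_density) auto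
  also have "\<dots> = ennreal (\<integral>\<theta>. normal_density \<theta> 1 y / evidence \<tau> y \<partial>horseshoe_coord \<tau>)"
    using integrable_normal_density_horseshoe[OF assms(1)] Z by (intro nn_integral_eq_integral) auto
  also have "\<dots> = 1" using Z by (simp add: evidence_def)
  finally show "emeasure (coord_posterior \<tau> y) (space (coord_posterior \<tau> y)) = 1" by simp
qed

lemma integral_coord_posterior:
  fixes f :: "real \<Rightarrow> real"
  assumes "0 < \<tau>" "\<tau> \<le> 1" and [measurable]: "f \<in> borel_measurable borel"
  shows "(\<integral>\<theta>. f \<theta> \<partial>coord_posterior \<tau> y) =
    (\<integral>\<theta>. normal_density \<theta> 1 y * f \<theta> \<partial>horseshoe_coord \<tau>) / evidence \<tau> y"
  unfolding coord_posterior_def using evidence_pos[OF assms(1,2), of y]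
  by (subst integral_density) (auto simp: less_imp_le)

lemma integral_coord_posterior_id:
  assumes "0 < \<tau>" "\<tau> \<le> 1"
  shows "(\<integral>\<theta>. \<theta> \<partial>coord_posterior \<tau> y) = coord_mean \<tau> y"
  using assms by (simp add: integral_coord_posterior coord_mean_def)

text \<open>Only local scales between A and 2 A are kept: they have mass at least 1 / (8 A), and
  given any of them the interval has probability at least \<delta> times its length.\<close>

lemma horseshoe_coord_Icc_ge:
  assumes "0 < \<tau>" "1 \<le> A" "a \<le> b" "0 \<le> \<delta>"
    and \<delta>: "\<And>l x. A \<le> l \<Longrightarrow> l \<le> 2 * A \<Longrightarrow> a \<le> x \<Longrightarrow> x \<le> b \<Longrightarrow> \<delta> \<le> normal_density 0 (l * \<tau>) x"
  shows "measure (horseshoe_coord \<tau>) {a..b} \<ge> \<delta> * (b - a) / (8 * A)"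
proof -
  interpret prob_space "horseshoe_coord \<tau>" using assms(1) by (rule prob_space_horseshoe_coord)
  have "ennreal (\<delta> * (b - a) / (8 * A)) = ennreal (\<delta> * (b - a)) * ennreal (1 / (8 * A))"
    using assms by (simp add: ennreal_mult[symmetric])
  also have "\<dots> \<le> ennreal (\<delta> * (b - a)) * emeasure half_cauchy {A..2 * A}"
    using half_cauchy_Icc[OF assms(2)]
    by (intro mult_left_mono) (auto simp: half_cauchy.emeasure_eq_measure intro!: ennreal_leI)
  also have "\<dots> = (\<integral>\<^sup>+l. ennreal (\<delta> * (b - a)) * indicator {A..2 * A} l \<partial>half_cauchy)"
    by (subst nn_integral_cmult_indicator) auto
  also have "\<dots> \<le> (\<integral>\<^sup>+l. emeasure (density lborel (normal_density 0 (l * \<tau>))) {a..b} \<partial>half_cauchy)"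
  proof (rule nn_integral_mono)
    fix l :: real
    have "ennreal (\<delta> * (b - a)) \<le> emeasure (density lborel (normal_density 0 (l * \<tau>))) {a..b}"
      if "A \<le> l" "l \<le> 2 * A"
    proof -
      have "ennreal (\<delta> * (b - a)) = (\<integral>\<^sup>+x. ennreal \<delta> * indicator {a..b} x \<partial>lborel)"
        using assms by (subst nn_integral_cmult_indicator) (auto simp: ennreal_mult)
      also have "\<dots> \<le> (\<integral>\<^sup>+x. ennreal (normal_density 0 (l * \<tau>) x) * indicator {a..b} x \<partial>lborel)"
        using \<delta>[OF that] by (intro nn_integral_mono) (auto split: split_indicator intro!: ennreal_leI)
      also have "\<dots> = emeasure (density lborel (normal_density 0 (l * \<tau>))) {a..b}"
        by (subst emeasure_density) auto
      finally show ?thesis .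
    qed
    then show "ennreal (\<delta> * (b - a)) * indicator {A..2 * A} l
        \<le> emeasure (density lborel (normal_density 0 (l * \<tau>))) {a..b}"
      by (auto split: split_indicator)
  qed
  also have "\<dots> = emeasure (horseshoe_coord \<tau>) {a..b}"
    by (subst emeasure_horseshoe_coord) auto
  finally show ?thesis by (simp add: emeasure_eq_measure)
qed

lemma sqrt_2pi_le_3: "sqrt (2 * pi) \<le> 3"
  using pi_approx by (intro real_le_lsqrt) auto

text \<open>Shaped for the hypothesis of \<open>horseshoe_coord_Icc_ge\<close>: \<open>r\<close> is
  the smallest deviation in the range of scales, and \<open>k\<close> bounds the number of
  deviations from 0.\<close>

lemma normal_density_0_ge:
  assumes "0 < s" "s \<le> 2 * r" "\<bar>x\<bar> \<le> k * s"
  shows "normal_density 0 s x \<ge> exp (- k\<^sup>2 / 2) / (6 * r)"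
proof -
  have "sqrt (2 * pi * s\<^sup>2) = sqrt (2 * pi) * s" using assms by (simp add: real_sqrt_mult)
  also have "\<dots> \<le> 3 * (2 * r)" using sqrt_2pi_le_3 assms by (intro mult_mono) auto
  finally have "sqrt (2 * pi * s\<^sup>2) \<le> 6 * r" by simp
  moreover have "exp (- k\<^sup>2 / 2) \<le> exp (- (x - 0)\<^sup>2 / (2 * s\<^sup>2))"
  proof -
    have "x\<^sup>2 \<le> k\<^sup>2 * s\<^sup>2"
      using power_mono[OF assms(3), of 2] by (simp add: power_mult_distrib)
    then show ?thesis using assms by (simp add: divide_simps mult.commute)
  qed
  ultimately have "exp (- k\<^sup>2 / 2) / (6 * r) \<le> exp (- (x - 0)\<^sup>2 / (2 * s\<^sup>2)) / sqrt (2 * pi * s\<^sup>2)"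
    using assms by (intro frac_le) auto
  then show ?thesis by (simp add: normal_density_def)
qed

lemma exp_minus_2_ge: "1 / 9 \<le> exp (- 2 :: real)"
proof -
  have "exp 2 = exp (1::real) ^ 2" by (simp add: exp_of_nat_mult[symmetric])
  also have "\<dots> \<le> 3 ^ 2" using exp_le by (intro power_mono) auto
  finally show ?thesis by (simp add: exp_minus divide_simps)
qed

text \<open>Scales of order y / \<tau> make the deviation lie between y and 2 y, so the interval is
  within two deviations of 0. The constant is 432 = 9 * 6 * 8, with 9 bounding exp 2.\<close>

lemma horseshoe_coord_far_ge:
  assumes "0 < \<tau>" "\<tau> \<le> 1" "1 \<le> y"
  shows "measure (horseshoe_coord \<tau>) {y..y + 1} \<ge> \<tau> / (432 * y\<^sup>2)"
proof -
  have "measure (horseshoe_coord \<tau>) {y..y + 1} \<ge> 1 / (54 * y) * (y + 1 - y) / (8 * (y / \<tau>))"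
  proof (rule horseshoe_coord_Icc_ge)
    fix l x assume lx: "y / \<tau> \<le> l" "l \<le> 2 * (y / \<tau>)" "y \<le> x" "x \<le> y + 1"
    then have s: "y \<le> l * \<tau>" "l * \<tau> \<le> 2 * y" using assms by (auto simp: divide_simps)
    have "1 / (54 * y) = 1 / 9 / (6 * y)" by simp
    also have "\<dots> \<le> exp (- 2\<^sup>2 / 2) / (6 * y)"
      using exp_minus_2_ge assms by (intro divide_right_mono) auto
    also have "\<dots> \<le> normal_density 0 (l * \<tau>) x"
      by (rule normal_density_0_ge) (use s lx assms in auto)
    finally show "1 / (54 * y) \<le> normal_density 0 (l * \<tau>) x" .
  qed (use assms in auto)
  then show ?thesis using assms by (simp add: power2_eq_square)
qed

text \<open>Scales between 1 and 2 give the spike at 0 a mass that does not depend on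
  \<tau>.\<close>

lemma horseshoe_coord_near_ge:
  assumes "0 < \<tau>"
  shows "measure (horseshoe_coord \<tau>) {0..\<tau>} \<ge> 1 / 96"
proof -
  have "measure (horseshoe_coord \<tau>) {0..\<tau>} \<ge> 1 / (12 * \<tau>) * (\<tau> - 0) / (8 * 1)"
  proof (rule horseshoe_coord_Icc_ge)
    fix l x :: real assume lx: "1 \<le> l" "l \<le> 2 * 1" "0 \<le> x" "x \<le> \<tau>"
    have "1 / (12 * \<tau>) = 1 / 2 / (6 * \<tau>)" by simp
    also have "\<dots> \<le> exp (- 1\<^sup>2 / 2) / (6 * \<tau>)"
      using exp_minus_half_ge assms by (intro divide_right_mono) auto
    also have "\<dots> \<le> normal_density 0 (l * \<tau>) x"
    proof (rule normal_density_0_ge)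
      have "1 * \<tau> \<le> l * \<tau>" using lx assms by (intro mult_right_mono) auto
      then show "\<bar>x\<bar> \<le> 1 * (l * \<tau>)" using lx by simp
    qed (use lx assms in auto)
    finally show "1 / (12 * \<tau>) \<le> normal_density 0 (l * \<tau>) x" .
  qed (use assms in auto)
  then show ?thesis using assms by simp
qed

text \<open>The truncation makes the summands bounded by \<zeta>^2, as
  \<open>product_lower_tail\<close> requires, while only lowering the sum of squares they stand
  for.\<close>

definition truncated_variance :: "real \<Rightarrow> real \<Rightarrow> real" where
  "truncated_variance \<tau> y =
    (\<integral>\<theta>. min ((\<theta> - coord_mean \<tau> y)\<^sup>2) ((horseshoe_threshold \<tau>)\<^sup>2) \<partial>coord_posterior \<tau> y)"

lemma truncated_variance_bounds:
  assumes "0 < \<tau>" "\<tau> \<le> 1"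
  shows "0 \<le> truncated_variance \<tau> y" "truncated_variance \<tau> y \<le> (horseshoe_threshold \<tau>)\<^sup>2"
proof -
  interpret prob_space "coord_posterior \<tau> y" using assms by (rule prob_space_coord_posterior)
  show "0 \<le> truncated_variance \<tau> y"
    unfolding truncated_variance_def by (rule integral_nonneg_AE) auto
  show "truncated_variance \<tau> y \<le> (horseshoe_threshold \<tau>)\<^sup>2"
    unfolding truncated_variance_def
    by (rule integral_le_const)
       (auto intro!: integrable_const_bound[of _ "(horseshoe_threshold \<tau>)\<^sup>2"])
qed

lemma measurable_truncated_variance:
  assumes "0 < \<tau>" "\<tau> \<le> 1"
  shows "truncated_variance \<tau> \<in> borel_measurable borel"
proof -
  interpret prob_space "horseshoe_coord \<tau>" using assms(1) by (rule prob_space_horseshoe_coord)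
  note [measurable] = measurable_coord_mean[OF assms(1)] measurable_evidence[OF assms(1)]
  show ?thesis
    unfolding truncated_variance_def using assms by (subst integral_coord_posterior) auto
qed

text \<open>Only parameters in \<open>B\<close> are kept in the numerator of Bayes' formula.\<close>

lemma truncated_variance_ge:
  assumes \<tau>: "0 < \<tau>" "\<tau> \<le> 1" and "0 \<le> q" "0 \<le> d" and [measurable]: "B \<in> sets borel"
    and q: "\<And>\<theta>. \<theta> \<in> B \<Longrightarrow> q \<le> (\<theta> - coord_mean \<tau> y)\<^sup>2" "q \<le> (horseshoe_threshold \<tau>)\<^sup>2"
    and d: "\<And>\<theta>. \<theta> \<in> B \<Longrightarrow> d \<le> normal_density \<theta> 1 y"
  shows "truncated_variance \<tau> y \<ge> q * d * measure (horseshoe_coord \<tau>) B / evidence \<tau> y"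
proof -
  interpret prob_space "horseshoe_coord \<tau>" using \<tau>(1) by (rule prob_space_horseshoe_coord)
  let ?w = "\<lambda>\<theta>. min ((\<theta> - coord_mean \<tau> y)\<^sup>2) ((horseshoe_threshold \<tau>)\<^sup>2)"
  have "q * d * measure (horseshoe_coord \<tau>) B = (\<integral>\<theta>. q * d * indicator B \<theta> \<partial>horseshoe_coord \<tau>)"
    by simp
  also have "\<dots> \<le> (\<integral>\<theta>. normal_density \<theta> 1 y * ?w \<theta> \<partial>horseshoe_coord \<tau>)"
  proof (rule integral_mono)
    show "integrable (horseshoe_coord \<tau>) (\<lambda>\<theta>. normal_density \<theta> 1 y * ?w \<theta>)"
      by (rule integrable_const_bound[of _ "1 * (horseshoe_threshold \<tau>)\<^sup>2"])
         (auto intro!: AE_I2 mult_left_le_one_le[THEN order.trans] simp: normal_density_unit_le abs_mult)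
    show "integrable (horseshoe_coord \<tau>) (\<lambda>\<theta>. q * d * indicator B \<theta>)"
      by (intro integrable_mult_right) (auto simp: emeasure_eq_measure)
    fix \<theta>
    have "d * q \<le> normal_density \<theta> 1 y * ?w \<theta>" if "\<theta> \<in> B"
      using q(1)[OF that] q(2) d[OF that] assms by (intro mult_mono) auto
    then show "q * d * indicator B \<theta> \<le> normal_density \<theta> 1 y * ?w \<theta>"
      by (auto split: split_indicator simp: mult.commute)
  qed
  finally show ?thesis
    unfolding truncated_variance_def using evidence_pos[OF \<tau>, of y]
    by (subst integral_coord_posterior[OF \<tau>]) (auto intro!: divide_right_mono)
qed

lemma exp_2_ge_4: "4 \<le> exp (2::real)"
proof -
  have "2 ^ 2 \<le> exp (1::real) ^ 2" using exp_ge_add_one_self[of "1::real"] by (intro power_mono) auto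
  then show ?thesis by (simp add: exp_of_nat_mult[symmetric])
qed

text \<open>Whichever side of \<open>y / 2\<close> the posterior mean lies on, either the slab near \<open>y\<close> or the spike near
  \<open>0\<close> is at distance of order \<open>y\<close> from it, and both carry enough posterior mass.\<close>

lemma normal_times_truncated_variance_ge:
  assumes \<tau>: "0 < \<tau>" "\<tau> \<le> 1" and \<zeta>: "2 \<le> horseshoe_threshold \<tau>"
    and y: "1 \<le> y" "y \<le> horseshoe_threshold \<tau>"
  shows "\<tau> / 82944 \<le> std_normal_density y * truncated_variance \<tau> y"
proof -
  define \<zeta> where "\<zeta> = horseshoe_threshold \<tau>"
  define \<phi> where "\<phi> = std_normal_density y"
  have \<phi>: "0 < \<phi>" unfolding \<phi>_def by (rule normal_density_pos) simp
  have y\<zeta>: "y\<^sup>2 \<le> \<zeta>\<^sup>2" using y by (auto simp: \<zeta>_def intro!: power_mono)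
  have e\<zeta>: "exp (\<zeta>\<^sup>2 / 2) = 1 / \<tau>" unfolding \<zeta>_def using \<tau> by (rule exp_horseshoe_threshold)
  have Z: "0 < evidence \<tau> y" using \<tau> by (rule evidence_pos)
  \<comment> \<open>Up to the threshold the evidence is at most 2 \<phi>, so the factor \<phi> in
    the claim cancels the denominator of the posterior up to a factor 2.\<close>
  have "\<tau> * exp (y\<^sup>2 / 2) \<le> \<tau> * exp (\<zeta>\<^sup>2 / 2)"
    using y\<zeta> \<tau> by (intro mult_left_mono) auto
  then have "\<tau> * exp (y\<^sup>2 / 2) \<le> 1" using \<tau> e\<zeta> by simp
  then have "\<phi> * (1 + \<tau> * exp (y\<^sup>2 / 2)) \<le> \<phi> * 2" using \<phi> by (intro mult_left_mono) auto
  with evidence_le[OF \<tau>(1), of y] have Z2: "evidence \<tau> y \<le> 2 * \<phi>" unfolding \<phi>_def by linarith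
  have *: "\<phi> * truncated_variance \<tau> y \<ge> q * d * \<mu> / 2"
    if "q * d * \<mu> / evidence \<tau> y \<le> truncated_variance \<tau> y" "0 \<le> q" "0 \<le> d" "0 \<le> \<mu>" for q d \<mu>
  proof -
    have "q * d * \<mu> / 2 = \<phi> * (q * d * \<mu> / (2 * \<phi>))" using \<phi> by simp
    also have "\<dots> \<le> \<phi> * (q * d * \<mu> / evidence \<tau> y)"
      using Z Z2 \<phi> that by (intro mult_left_mono divide_left_mono) auto
    also have "\<dots> \<le> \<phi> * truncated_variance \<tau> y"
      using that \<phi> by (intro mult_left_mono) auto
    finally show ?thesis .
  qed
  have y0: "0 \<le> y\<^sup>2" "1 \<le> y\<^sup>2" using y one_le_power[of y 2] by auto
  show ?thesis
  proof (cases "coord_mean \<tau> y \<le> y / 2")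
    case True
    let ?\<mu> = "measure (horseshoe_coord \<tau>) {y..y + 1}"
    \<comment> \<open>The slab: squared distance at least y^2 / 16 and likelihood at least 1/6. With
      the prior mass from \<open>horseshoe_coord_far_ge\<close> the powers of y cancel, and 16 * 6 *
      432 * 2 = 82944.\<close>
    have "(y\<^sup>2 / 16) * (1 / 6) * ?\<mu> / evidence \<tau> y \<le> truncated_variance \<tau> y"
    proof (rule truncated_variance_ge[OF \<tau>])
      fix \<theta> assume "\<theta> \<in> {y..y + 1}"
      then have \<theta>: "y \<le> \<theta>" "\<theta> \<le> y + 1" by auto
      have "(y / 4)\<^sup>2 \<le> (\<theta> - coord_mean \<tau> y)\<^sup>2" using True \<theta> y by (intro power_mono) auto
      then show "y\<^sup>2 / 16 \<le> (\<theta> - coord_mean \<tau> y)\<^sup>2" by (simp add: power_divide)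
      have "(y - \<theta>)\<^sup>2 \<le> 1" using \<theta> by (simp add: abs_square_le_1)
      then have "exp (- 1 / 2) \<le> exp (- (y - \<theta>)\<^sup>2 / 2)" by simp
      with exp_minus_half_ge have "1 / 2 \<le> exp (- (y - \<theta>)\<^sup>2 / 2)" by linarith
      then have "(1 / 2) / 3 \<le> exp (- (y - \<theta>)\<^sup>2 / 2) / sqrt (2 * pi)"
        using sqrt_2pi_le_3 by (intro frac_le) auto
      then show "1 / 6 \<le> normal_density \<theta> 1 y" by (simp add: normal_density_def)
    qed (use y\<zeta> y0 in \<open>auto simp: \<zeta>_def\<close>)
    then have "(y\<^sup>2 / 16) * (1 / 6) * ?\<mu> / 2 \<le> \<phi> * truncated_variance \<tau> y"
      by (rule *) auto
    moreover have "(y\<^sup>2 / 16) * (1 / 6) * (\<tau> / (432 * y\<^sup>2)) / 2 \<le> (y\<^sup>2 / 16) * (1 / 6) * ?\<mu> / 2"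
      using horseshoe_coord_far_ge[OF \<tau> y(1)] by (intro divide_right_mono mult_left_mono) auto
    moreover have "(y\<^sup>2 / 16) * (1 / 6) * (\<tau> / (432 * y\<^sup>2)) / 2 = \<tau> / 82944"
      using y by simp
    ultimately show ?thesis by (simp add: \<phi>_def)
  next
    case False
    let ?\<mu> = "measure (horseshoe_coord \<tau>) {0..\<tau>}"
    \<comment> \<open>This keeps the spike, the interval from 0 to \<tau>, below y / 4 and hence at
      distance at least y / 4 from the posterior mean.\<close>
    have "\<tau> \<le> 1 / 4"
    proof -
      have "2\<^sup>2 \<le> \<zeta>\<^sup>2" using \<zeta> unfolding \<zeta>_def by (intro power_mono) auto
      then have "exp 2 \<le> exp (\<zeta>\<^sup>2 / 2)" by simp
      with exp_2_ge_4 e\<zeta> have "4 \<le> 1 / \<tau>" by linarith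
      then show ?thesis using \<tau> by (simp add: field_simps)
    qed
    have "(y\<^sup>2 / 16) * \<phi> * ?\<mu> / evidence \<tau> y \<le> truncated_variance \<tau> y"
    proof (rule truncated_variance_ge[OF \<tau>])
      fix \<theta> assume "\<theta> \<in> {0..\<tau>}"
      then have \<theta>: "0 \<le> \<theta>" "\<theta> \<le> y / 4" using \<open>\<tau> \<le> 1 / 4\<close> y by auto
      have "(y / 4)\<^sup>2 \<le> (coord_mean \<tau> y - \<theta>)\<^sup>2" using False \<theta> y by (intro power_mono) auto
      then show "y\<^sup>2 / 16 \<le> (\<theta> - coord_mean \<tau> y)\<^sup>2" by (simp add: power_divide power2_commute)
      have "(y - \<theta>)\<^sup>2 \<le> y\<^sup>2" using \<theta> y by (intro power_mono) auto
      then have "exp (- y\<^sup>2 / 2) \<le> exp (- (y - \<theta>)\<^sup>2 / 2)" by simp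
      then show "\<phi> \<le> normal_density \<theta> 1 y"
        by (simp add: \<phi>_def normal_density_def divide_right_mono)
    qed (use y\<zeta> y0 \<phi> in \<open>auto simp: \<zeta>_def\<close>)
    then have "(y\<^sup>2 / 16) * \<phi> * ?\<mu> / 2 \<le> \<phi> * truncated_variance \<tau> y"
      by (rule *) (use \<phi> in auto)
    \<comment> \<open>The spike has constant prior mass, so the factor \<tau> comes from the
      likelihood \<phi>, which at the threshold is still at least \<tau> / 3.\<close>
    moreover have "(1 / 16) * (\<tau> / 3) * (1 / 96) / 2 \<le> (y\<^sup>2 / 16) * \<phi> * ?\<mu> / 2"
    proof -
      have "\<tau> / 3 \<le> exp (- \<zeta>\<^sup>2 / 2) / sqrt (2 * pi)"
      proof -
        have "exp (- \<zeta>\<^sup>2 / 2) = \<tau>" using e\<zeta> by (simp add: exp_minus)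
        then show ?thesis using sqrt_2pi_le_3 \<tau> by (simp only:) (intro frac_le, auto)
      qed
      also have "\<dots> \<le> \<phi>"
        using y\<zeta> by (simp add: \<phi>_def std_normal_density_eq divide_right_mono)
      finally have "\<tau> / 3 \<le> \<phi>" .
      then show ?thesis
        using horseshoe_coord_near_ge[OF \<tau>(1)] y0 \<tau> by (intro divide_right_mono mult_mono) auto
    qed
    ultimately show ?thesis using \<tau> by (simp add: \<phi>_def)
  qed
qed

text \<open>The pointwise bound is integrated over the data between 1 and \<zeta>, an interval of
  length at least \<zeta> / 2; hence 165888 = 2 * 82944.\<close>

lemma integral_truncated_variance_ge:
  assumes \<tau>: "0 < \<tau>" "\<tau> \<le> 1" and \<zeta>: "2 \<le> horseshoe_threshold \<tau>"
  shows "\<tau> * horseshoe_threshold \<tau> / 165888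
    \<le> (\<integral>y. truncated_variance \<tau> y \<partial>density lborel std_normal_density)"
proof -
  define \<zeta> where "\<zeta> = horseshoe_threshold \<tau>"
  let ?v = "truncated_variance \<tau>"
  interpret prob_space "density lborel std_normal_density" by (rule prob_space_normal_density) simp
  note [measurable] = measurable_truncated_variance[OF \<tau>]
  note v = truncated_variance_bounds[OF \<tau>]
  have "\<tau> * \<zeta> / 165888 \<le> \<tau> / 82944 * (\<zeta> - 1)"
    using mult_left_mono[OF \<zeta>, of \<tau>] \<tau> by (simp add: \<zeta>_def right_diff_distrib)
  also have "\<dots> = (\<integral>y. \<tau> / 82944 * indicator {1..\<zeta>} y \<partial>lborel)"
    using \<zeta> by (simp add: \<zeta>_def)
  also have "\<dots> \<le> (\<integral>y. std_normal_density y * ?v y \<partial>lborel)"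
  proof (rule integral_mono)
    show "integrable lborel (\<lambda>y. \<tau> / 82944 * indicator {1..\<zeta>} y :: real)"
      by (intro integrable_mult_right integrable_real_indicator) (auto simp: emeasure_lborel_Icc_eq)
    show "integrable lborel (\<lambda>y. std_normal_density y * ?v y)"
    proof (rule Bochner_Integration.integrable_bound)
      show "integrable lborel (\<lambda>y. std_normal_density y * \<zeta>\<^sup>2)" by simp
      show "AE y in lborel. norm (std_normal_density y * ?v y) \<le> norm (std_normal_density y * \<zeta>\<^sup>2)"
        using v by (auto intro!: mult_left_mono simp: abs_mult \<zeta>_def)
    qed measurable
    fix y
    show "\<tau> / 82944 * indicator {1..\<zeta>} y \<le> std_normal_density y * ?v y"
      using normal_times_truncated_variance_ge[OF \<tau> \<zeta>, of y] v(1)[of y]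
      by (auto split: split_indicator simp: \<zeta>_def)
  qed
  also have "\<dots> = (\<integral>y. ?v y \<partial>density lborel std_normal_density)"
    by (subst integral_density) auto
  finally show ?thesis by (simp add: \<zeta>_def)
qed

subsection \<open>Product measures\<close>

lemma exp_minus_le_linear:
  fixes t :: real
  assumes "0 \<le> t" "t \<le> 1"
  shows "exp (- t) \<le> 1 - t / 2"
proof -
  have "exp (t * - 1) \<le> 1 - t + t * exp (- 1 :: real)"
    by (rule exp_mult_le_chord) (use assms in auto)
  moreover have "exp (- 1 :: real) \<le> 1 / 2"
    using exp_ge_add_one_self[of "1::real"] by (simp add: exp_minus divide_simps)
  then have "t * exp (- 1) \<le> t * (1 / 2)" by (rule mult_left_mono) (use assms in auto)
  ultimately show ?thesis by simp
qed

text \<open>Chernoff's method with parameter 1 / B. Each factor of the Laplace transform is at most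
  exp (- m / (2 B)) for its mean m, and Markov's inequality at level \<mu> / 4 gives back exp (\<mu>
  / (4 B)).\<close>

lemma product_lower_tail:
  fixes M :: "'i \<Rightarrow> 'a measure" and w :: "'i \<Rightarrow> 'a \<Rightarrow> real"
  assumes M: "\<And>i. prob_space (M i)" and I: "finite I"
    and [measurable]: "\<And>i. i \<in> I \<Longrightarrow> w i \<in> borel_measurable (M i)"
    and w: "\<And>i x. i \<in> I \<Longrightarrow> 0 \<le> w i x" "\<And>i x. i \<in> I \<Longrightarrow> w i x \<le> B" and "0 < B"
  defines "\<mu> \<equiv> \<Sum>i\<in>I. \<integral>x. w i x \<partial>M i"
  shows "measure (PiM I M) {x \<in> space (PiM I M). (\<Sum>i\<in>I. w i (x i)) \<le> \<mu> / 4} \<le> exp (- \<mu> / (4 * B))"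
proof -
  interpret M: prob_space "M i" for i by (rule M)
  interpret product_sigma_finite M ..
  interpret P: prob_space "PiM I M" by (rule prob_space_PiM) (rule M)
  define e where "e = (\<lambda>x. \<Prod>i\<in>I. exp (- w i (x i) / B))"
  have e_eq: "e x = exp (- (\<Sum>i\<in>I. w i (x i)) / B)" for x
    by (simp add: e_def exp_sum[OF I, symmetric] sum_negf sum_divide_distrib)
  have [measurable]: "e \<in> borel_measurable (PiM I M)" unfolding e_def by measurable
  have w_int: "integrable (M i) (w i)" if "i \<in> I" for i
    using w[OF that] that by (intro M.integrable_const_bound[of _ B]) auto
  have e_int: "integrable (M i) (\<lambda>x. exp (- w i x / B))" if "i \<in> I" for i
    using w[OF that] that \<open>0 < B\<close> by (intro M.integrable_const_bound[of _ 1]) auto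
  have "(\<integral>x. e x \<partial>PiM I M) = (\<Prod>i\<in>I. \<integral>x. exp (- w i x / B) \<partial>M i)"
    unfolding e_def by (rule product_integral_prod[OF I e_int])
  also have "\<dots> \<le> (\<Prod>i\<in>I. exp (- (\<integral>x. w i x \<partial>M i) / (2 * B)))"
  proof (rule prod_mono, intro conjI)
    fix i assume i: "i \<in> I"
    show "0 \<le> (\<integral>x. exp (- w i x / B) \<partial>M i)" by (rule integral_nonneg_AE) auto
    have "(\<integral>x. exp (- w i x / B) \<partial>M i) \<le> (\<integral>x. 1 - w i x / (2 * B) \<partial>M i)"
    proof (rule integral_mono[OF e_int[OF i]])
      show "integrable (M i) (\<lambda>x. 1 - w i x / (2 * B))" using w_int[OF i] by auto
      fix x
      show "exp (- w i x / B) \<le> 1 - w i x / (2 * B)"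
        using exp_minus_le_linear[of "w i x / B"] w[OF i, of x] \<open>0 < B\<close> by (simp add: field_simps)
    qed
    also have "\<dots> = 1 + - (\<integral>x. w i x \<partial>M i) / (2 * B)"
      using w_int[OF i] M.prob_space[of i] by simp
    also have "\<dots> \<le> exp (- (\<integral>x. w i x \<partial>M i) / (2 * B))" by (rule exp_ge_add_one_self)
    finally show "(\<integral>x. exp (- w i x / B) \<partial>M i) \<le> exp (- (\<integral>x. w i x \<partial>M i) / (2 * B))" .
  qed
  also have "\<dots> = exp (- \<mu> / (2 * B))"
    by (simp add: exp_sum[OF I, symmetric] \<mu>_def sum_negf sum_divide_distrib)
  finally have E: "(\<integral>x. e x \<partial>PiM I M) \<le> exp (- \<mu> / (2 * B))" .
  have e1: "0 \<le> e x" "e x \<le> 1" for x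
    using w \<open>0 < B\<close> by (auto simp: e_eq sum_nonneg)
  have "{x \<in> space (PiM I M). (\<Sum>i\<in>I. w i (x i)) \<le> \<mu> / 4} = {x \<in> space (PiM I M). e x \<ge> exp (- \<mu> / (4 * B))}"
    using \<open>0 < B\<close> by (auto simp: e_eq field_simps)
  also have "measure (PiM I M) \<dots> \<le> (\<integral>x. e x \<partial>PiM I M) / exp (- \<mu> / (4 * B))"
    by (rule integral_Markov_inequality_measure[where A = "{}"])
       (use e1 in \<open>auto intro!: P.integrable_const_bound[of _ 1]\<close>)
  also have "\<dots> \<le> exp (- \<mu> / (2 * B)) / exp (- \<mu> / (4 * B))"
    using E by (rule divide_right_mono) simp
  also have "\<dots> = exp (- \<mu> / (4 * B))"
    using \<open>0 < B\<close> by (simp add: exp_diff[symmetric] field_simps)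
  finally show ?thesis .
qed

text \<open>Product measures are determined by boxes, and on a box both the density and the
  indicator factorise over the coordinates.\<close>

lemma density_PiM:
  assumes M: "\<And>i. prob_space (M i)" and I: "finite I"
    and [measurable]: "\<And>i. f i \<in> borel_measurable (M i)"
    and N: "\<And>i. prob_space (density (M i) (f i))"
  shows "density (PiM I M) (\<lambda>x. \<Prod>i\<in>I. f i (x i)) = PiM I (\<lambda>i. density (M i) (f i))"
proof -
  interpret M: prob_space "M i" for i by (rule M)
  interpret M: product_sigma_finite M ..
  interpret N: prob_space "density (M i) (f i)" for i by (rule N)
  interpret N: product_sigma_finite "\<lambda>i. density (M i) (f i)" ..
  show ?thesis
  proof (rule N.PiM_eqI[OF I])
    show "sets (density (PiM I M) (\<lambda>x. \<Prod>i\<in>I. f i (x i))) = sets (PiM I (\<lambda>i. density (M i) (f i)))"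
      by (simp cong: sets_PiM_cong)
    fix A assume "\<And>i. i \<in> I \<Longrightarrow> A i \<in> sets (density (M i) (f i))"
    then have A [measurable]: "\<And>i. i \<in> I \<Longrightarrow> A i \<in> sets (M i)" by simp
    have "PiE I A \<in> sets (PiM I M)" using A I by (intro sets_PiM_I_finite) auto
    then have "emeasure (density (PiM I M) (\<lambda>x. \<Prod>i\<in>I. f i (x i))) (PiE I A) =
        (\<integral>\<^sup>+x. (\<Prod>i\<in>I. f i (x i)) * indicator (PiE I A) x \<partial>PiM I M)"
      using I by (subst emeasure_density) auto
    also have "\<dots> = (\<integral>\<^sup>+x. (\<Prod>i\<in>I. f i (x i) * indicator (A i) (x i)) \<partial>PiM I M)"
    proof (rule nn_integral_cong)
      fix x assume "x \<in> space (PiM I M)"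
      then have "indicator (PiE I A) x = (\<Prod>i\<in>I. indicator (A i) (x i) :: ennreal)"
        using I by (auto simp: space_PiM PiE_iff indicator_def prod_zero_iff split: if_splits)
      then show "(\<Prod>i\<in>I. f i (x i)) * indicator (PiE I A) x = (\<Prod>i\<in>I. f i (x i) * indicator (A i) (x i))"
        by (simp add: prod.distrib)
    qed
    also have "\<dots> = (\<Prod>i\<in>I. \<integral>\<^sup>+x. f i x * indicator (A i) x \<partial>M i)"
      by (rule M.product_nn_integral_prod[OF I]) measurable
    also have "\<dots> = (\<Prod>i\<in>I. emeasure (density (M i) (f i)) (A i))"
      using A by (intro prod.cong refl) (simp add: emeasure_density)
    finally show "emeasure (density (PiM I M) (\<lambda>x. \<Prod>i\<in>I. f i (x i))) (PiE I A) =
        (\<Prod>i\<in>I. emeasure (density (M i) (f i)) (A i))" .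
  qed
qed

section \<open>The posterior as a product measure\<close>

lemma integral_likelihood:
  assumes "0 < \<tau>"
  shows "(\<integral>\<theta>. likelihood n y \<theta> \<partial>horseshoe_prior n \<tau>) = (\<Prod>i\<in>{1..n}. evidence \<tau> (y i))"
proof -
  interpret K: prob_space "horseshoe_coord \<tau>" using assms by (rule prob_space_horseshoe_coord)
  interpret product_sigma_finite "\<lambda>_::nat. horseshoe_coord \<tau>" ..
  show ?thesis
    unfolding likelihood_def horseshoe_prior_def evidence_def
    by (rule product_integral_prod) (auto intro: integrable_normal_density_horseshoe[OF assms])
qed

text \<open>Prior, likelihood and normalising constant all factorise, so the coordinates are
  independent under the posterior. This allows \<open>product_lower_tail\<close> to be used
  there.\<close>

lemma posterior_eq:
  assumes "0 < \<tau>" "\<tau> \<le> 1"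
  shows "posterior n \<tau> y = (\<Pi>\<^sub>M i\<in>{1..n}. coord_posterior \<tau> (y i))"
proof -
  interpret K: prob_space "horseshoe_coord \<tau>" using assms(1) by (rule prob_space_horseshoe_coord)
  have Z: "0 < evidence \<tau> (y i)" for i using assms by (rule evidence_pos)
  have "ennreal (likelihood n y \<theta> / (\<integral>\<theta>'. likelihood n y \<theta>' \<partial>horseshoe_prior n \<tau>)) =
      (\<Prod>i\<in>{1..n}. ennreal (normal_density (\<theta> i) 1 (y i) / evidence \<tau> (y i)))" for \<theta>
    unfolding integral_likelihood[OF assms(1)] using Z by (subst prod_ennreal) (auto simp: likelihood_def prod_dividef less_imp_le)
  then show ?thesis
    unfolding posterior_def horseshoe_prior_def coord_posterior_def
    using prob_space_coord_posterior[OF assms]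
    by (simp, subst density_PiM[symmetric]) (auto simp: coord_posterior_def K.prob_space_axioms)
qed

lemma prob_space_posterior:
  assumes "0 < \<tau>" "\<tau> \<le> 1"
  shows "prob_space (posterior n \<tau> y)"
  unfolding posterior_eq[OF assms] by (rule prob_space_PiM) (rule prob_space_coord_posterior[OF assms])

lemma sets_posterior [simp, measurable_cong]: "sets (posterior n \<tau> y) = sets (\<Pi>\<^sub>M i\<in>{1..n}. borel)"
  unfolding posterior_def horseshoe_prior_def by (simp cong: sets_PiM_cong)

lemma space_posterior [simp]: "space (posterior n \<tau> y) = space (\<Pi>\<^sub>M i\<in>{1..n}. borel)"
  by (rule sets_eq_imp_space_eq) simp

lemma posterior_mean_eq:
  assumes "0 < \<tau>" "\<tau> \<le> 1"
  shows "posterior_mean n \<tau> y = (\<lambda>i\<in>{1..n}. coord_mean \<tau> (y i))"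
proof -
  have "(\<integral>\<theta>. \<theta> i \<partial>posterior n \<tau> y) = coord_mean \<tau> (y i)" if "i \<in> {1..n}" for i
  proof -
    have "coord_mean \<tau> (y i) = (\<integral>t. t \<partial>distr (posterior n \<tau> y) (coord_posterior \<tau> (y i)) (\<lambda>\<theta>. \<theta> i))"
      unfolding posterior_eq[OF assms]
      by (subst distr_PiM_component)
         (use that prob_space_coord_posterior[OF assms] integral_coord_posterior_id[OF assms] in auto)
    also have "\<dots> = (\<integral>\<theta>. \<theta> i \<partial>posterior n \<tau> y)"
      by (rule integral_distr) (use that in measurable)
    finally show ?thesis ..
  qed
  then show ?thesis by (auto simp: posterior_mean_def)
qed

text \<open>Absence of atoms passes from the normal laws to their mixture and then to any law with a
  density against it. It makes the mass of balls continuous in the radius.\<close>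

lemma coord_posterior_singleton:
  assumes "0 < \<tau>"
  shows "emeasure (coord_posterior \<tau> y) {a} = 0"
proof -
  have "emeasure (horseshoe_coord \<tau>) {a} = 0"
  proof -
    have "emeasure (density lborel (normal_density 0 (l * \<tau>))) {a} = 0" for l
      by (subst emeasure_density) (auto simp: nn_integral_0_iff_AE AE_lborel_singleton split: split_indicator
        intro: AE_mp[OF AE_lborel_singleton[of a]])
    then show ?thesis by (subst emeasure_horseshoe_coord) auto
  qed
  then have "{a} \<in> null_sets (horseshoe_coord \<tau>)" by auto
  then have "{a} \<in> null_sets (coord_posterior \<tau> y)"
    unfolding coord_posterior_def
  proof (subst null_sets_density_iff)
    assume "{a} \<in> null_sets (horseshoe_coord \<tau>)"
    from AE_not_in[OF this]
    have "AE x in horseshoe_coord \<tau>. x \<in> {a} \<longrightarrow> ennreal (normal_density x 1 y / evidence \<tau> y) = 0"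
      by eventually_elim auto
    then show "{a} \<in> sets (horseshoe_coord \<tau>) \<and>
        (AE x in horseshoe_coord \<tau>. x \<in> {a} \<longrightarrow> ennreal (normal_density x 1 y / evidence \<tau> y) = 0)"
      by simp
  qed measurable
  then show ?thesis by auto
qed

text \<open>The prior charges every nondegenerate interval and the likelihood is strictly positive.
  This makes the mass of balls strictly increasing in the radius.\<close>

lemma coord_posterior_Icc_pos:
  assumes \<tau>: "0 < \<tau>" "\<tau> \<le> 1" and "a < b"
  shows "0 < measure (coord_posterior \<tau> y) {a..b}"
proof -
  interpret K: prob_space "horseshoe_coord \<tau>" using \<tau>(1) by (rule prob_space_horseshoe_coord)
  interpret prob_space "coord_posterior \<tau> y" using \<tau> by (rule prob_space_coord_posterior)
  \<comment> \<open>Chosen so that |x| \<le> k \<tau> for every x in the interval; scales of at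
    least 1 then satisfy the hypothesis of \<open>normal_density_0_ge\<close>.\<close>
  define k where "k = (\<bar>a\<bar> + \<bar>b\<bar>) / \<tau>"
  have "exp (- k\<^sup>2 / 2) / (6 * \<tau>) * (b - a) / (8 * 1) \<le> measure (horseshoe_coord \<tau>) {a..b}"
  proof (rule horseshoe_coord_Icc_ge)
    fix l x :: real assume lx: "1 \<le> l" "l \<le> 2 * 1" "a \<le> x" "x \<le> b"
    show "exp (- k\<^sup>2 / 2) / (6 * \<tau>) \<le> normal_density 0 (l * \<tau>) x"
    proof (rule normal_density_0_ge)
      have "\<bar>x\<bar> \<le> k * \<tau> * 1" using lx \<tau> by (simp add: k_def)
      also have "\<dots> \<le> k * \<tau> * l" using lx \<tau> by (intro mult_left_mono) (auto simp: k_def)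
      finally show "\<bar>x\<bar> \<le> k * (l * \<tau>)" by (simp add: mult_ac)
    qed (use lx \<tau> in auto)
  qed (use assms in auto)
  moreover have "0 < exp (- k\<^sup>2 / 2) / (6 * \<tau>) * (b - a) / (8 * 1)" using assms by simp
  ultimately have K: "0 < measure (horseshoe_coord \<tau>) {a..b}" by linarith
  have "{a..b} \<notin> null_sets (coord_posterior \<tau> y)"
  proof
    assume "{a..b} \<in> null_sets (coord_posterior \<tau> y)"
    then have "AE x in horseshoe_coord \<tau>. x \<in> {a..b} \<longrightarrow> ennreal (normal_density x 1 y / evidence \<tau> y) = 0"
      unfolding coord_posterior_def by (subst (asm) null_sets_density_iff) auto
    then have "AE x in horseshoe_coord \<tau>. x \<notin> {a..b}"
    proof eventually_elim
      case (elim x)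
      have "0 < normal_density x 1 y / evidence \<tau> y"
        using evidence_pos[OF \<tau>, of y] by (simp add: normal_density_pos)
      then show ?case using elim by (auto simp: ennreal_eq_0_iff)
    qed
    then have "{a..b} \<in> null_sets (horseshoe_coord \<tau>)"
      by (subst (asm) AE_iff_null) (auto simp: atLeastAtMost_def atLeast_def atMost_def Collect_conj_eq)
    with K show False by (auto simp: measure_def)
  qed
  then show ?thesis
    by (auto simp: null_sets_def emeasure_eq_measure zero_less_measure_iff)
qed

section \<open>Spheres and annuli under a product law\<close>

lemma l2_dist_nonneg: "0 \<le> l2_dist n \<theta> \<theta>'"
  by (simp add: l2_dist_def)

lemma l2_dist_power2: "(l2_dist n \<theta> \<theta>')\<^sup>2 = (\<Sum>i\<in>{1..n}. (\<theta> i - \<theta>' i)\<^sup>2)"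
  by (simp add: l2_dist_def L2_set_def sum_nonneg)

lemma l2_dist_le_iff: "0 \<le> t \<Longrightarrow> l2_dist n \<theta> \<theta>' \<le> t \<longleftrightarrow> (\<Sum>i\<in>{1..n}. (\<theta> i - \<theta>' i)\<^sup>2) \<le> t\<^sup>2"
  unfolding l2_dist_power2[symmetric] using l2_dist_nonneg[of n \<theta> \<theta>']
  by (auto intro: power_mono power2_le_imp_le)

lemma measurable_l2_dist [measurable]:
  assumes "\<And>i. i \<in> {1..n} \<Longrightarrow> (\<lambda>x. f x i) \<in> borel_measurable M" "\<And>i. i \<in> {1..n} \<Longrightarrow> (\<lambda>x. g x i) \<in> borel_measurable M"
  shows "(\<lambda>x. l2_dist n (f x) (g x)) \<in> borel_measurable M"
  unfolding l2_dist_def L2_set_def using assms by measurable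

text \<open>Fubini in the first coordinate: with the others fixed, the sphere contains at most two
  values of it, and these are not atoms.\<close>

lemma product_sphere_null:
  fixes Q :: "nat \<Rightarrow> real measure"
  assumes Q: "\<And>i. prob_space (Q i)" and S: "\<And>i. sets (Q i) = sets borel"
    and atom: "\<And>i a. emeasure (Q i) {a} = 0" and "1 \<le> n"
  shows "emeasure (PiM {1..n} Q) {\<theta> \<in> space (PiM {1..n} Q). l2_dist n \<theta> c = r} = 0"
proof -
  note [measurable_cong] = S
  interpret Q: prob_space "Q i" for i by (rule Q)
  interpret product_sigma_finite Q ..
  let ?A = "{\<theta> \<in> space (PiM {1..n} Q). l2_dist n \<theta> c = r}"
  have A [measurable]: "?A \<in> sets (PiM {1..n} Q)" by measurable
  have ins: "{1..n} = insert 1 {2..n}" using \<open>1 \<le> n\<close> by auto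
  have "emeasure (PiM {1..n} Q) ?A = (\<integral>\<^sup>+\<theta>. indicator ?A \<theta> \<partial>PiM {1..n} Q)" by simp
  also have "\<dots> = (\<integral>\<^sup>+x. (\<integral>\<^sup>+t. indicator ?A (x(1 := t)) \<partial>Q 1) \<partial>PiM {2..n} Q)"
    unfolding ins using A[THEN borel_measurable_indicator, unfolded ins]
    by (intro product_nn_integral_insert) auto
  also have "\<dots> = (\<integral>\<^sup>+x. 0 \<partial>PiM {2..n} Q)"
  proof (rule nn_integral_cong)
    fix x
    define R where "R = (\<Sum>i\<in>{2..n}. (x i - c i)\<^sup>2)"
    let ?s = "sqrt (r\<^sup>2 - R)"
    have "(\<integral>\<^sup>+t. indicator ?A (x(1 := t)) \<partial>Q 1) \<le> (\<integral>\<^sup>+t. indicator {c 1 + ?s} t + indicator {c 1 - ?s} t \<partial>Q 1)"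
    proof (rule nn_integral_mono)
      fix t
      have "t = c 1 + ?s \<or> t = c 1 - ?s" if "l2_dist n (x(1 := t)) c = r"
      proof -
        have "r\<^sup>2 = (t - c 1)\<^sup>2 + R"
          unfolding that[symmetric] l2_dist_power2 R_def ins by (auto intro!: sum.cong)
        then have "?s = \<bar>t - c 1\<bar>" by simp
        then show ?thesis by (auto simp: abs_if split: if_splits)
      qed
      then show "indicator ?A (x(1 := t)) \<le> indicator {c 1 + ?s} t + (indicator {c 1 - ?s} t :: ennreal)"
        by (auto split: split_indicator)
    qed
    also have "\<dots> = 0" by (subst nn_integral_add) (auto simp: atom S)
    finally show "(\<integral>\<^sup>+t. indicator ?A (x(1 := t)) \<partial>Q 1) = 0" by simp
  qed
  finally show ?thesis by simp
qed

text \<open>The annulus contains a box with nondegenerate sides, and a box has the product of the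
  masses of its sides.\<close>

lemma product_annulus_pos:
  fixes Q :: "nat \<Rightarrow> real measure"
  assumes Q: "\<And>i. prob_space (Q i)" and S: "\<And>i. sets (Q i) = sets borel"
    and pos: "\<And>i a b. a < b \<Longrightarrow> 0 < measure (Q i) {a..b}" and "1 \<le> n" "0 \<le> r" "r < s"
  shows "0 < measure (PiM {1..n} Q) {\<theta> \<in> space (PiM {1..n} Q). r < l2_dist n \<theta> c \<and> l2_dist n \<theta> c \<le> s}"
    (is "0 < measure ?P ?A")
proof -
  note [measurable_cong] = S
  interpret finite_product_prob_space Q "{1..n}"
    using Q by (simp add: finite_product_prob_space_def finite_product_sigma_finite_def
      product_prob_space_def product_prob_space_axioms_def product_sigma_finite_def prob_space_imp_sigma_finite
      finite_product_sigma_finite_axioms_def)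
  \<comment> \<open>Offsets between \<open>a\<close> and \<open>b\<close> in all n coordinates give
    a norm between (r + s) / 2 and s; the midpoint makes the lower inequality strict.\<close>
  define a where "a = (r + s) / 2 / sqrt n"
  define b where "b = s / sqrt n"
  have "a < b"
    unfolding a_def b_def using assms by (intro divide_strict_right_mono) auto
  then have ab: "0 \<le> a" "a < b" using assms by (auto simp: a_def)
  let ?B = "\<Pi>\<^sub>E i\<in>{1..n}. {c i + a..c i + b}"
  have "?B \<subseteq> ?A"
  proof
    fix \<theta> assume B: "\<theta> \<in> ?B"
    then have \<theta>: "a \<le> \<theta> i - c i" "\<theta> i - c i \<le> b" if "i \<in> {1..n}" for i
      using that by (force simp: PiE_iff)+
    have "(\<Sum>i\<in>{1..n}. a\<^sup>2) \<le> (l2_dist n \<theta> c)\<^sup>2" "(l2_dist n \<theta> c)\<^sup>2 \<le> (\<Sum>i\<in>{1..n}. b\<^sup>2)"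
      unfolding l2_dist_power2
      by (rule sum_mono, rule power_mono; use \<theta> ab order.trans[OF ab(1) \<theta>(1)] in simp)+
    then have "((r + s) / 2)\<^sup>2 \<le> (l2_dist n \<theta> c)\<^sup>2" "(l2_dist n \<theta> c)\<^sup>2 \<le> s\<^sup>2"
      using \<open>1 \<le> n\<close> by (simp_all add: a_def b_def power_divide)
    then have "(r + s) / 2 \<le> l2_dist n \<theta> c" "l2_dist n \<theta> c \<le> s"
      using assms l2_dist_nonneg[of n \<theta> c] by (auto intro: power2_le_imp_le)
    then show "\<theta> \<in> ?A"
      using B assms(5,6) sets_eq_imp_space_eq[OF S] by (auto simp: space_PiM PiE_iff)
  qed
  then have "measure ?P ?B \<le> measure ?P ?A"
    by (rule finite_measure_mono) measurable
  moreover have "measure ?P ?B = (\<Prod>i\<in>{1..n}. measure (Q i) {c i + a..c i + b})"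
    by (rule finite_measure_PiM_emb) (simp add: S)
  moreover have "0 < (\<Prod>i\<in>{1..n}. measure (Q i) {c i + a..c i + b})"
    using ab by (intro prod_pos) (auto intro: pos)
  ultimately show ?thesis by linarith
qed

subsection \<open>The credible radius and coverage\<close>

definition ball_mass :: "nat \<Rightarrow> real \<Rightarrow> (nat \<Rightarrow> real) \<Rightarrow> real \<Rightarrow> real" where
  "ball_mass n \<tau> y t = measure (posterior n \<tau> y)
    {\<theta> \<in> space (posterior n \<tau> y). l2_dist n \<theta> (posterior_mean n \<tau> y) \<le> t}"

text \<open>The ball mass is the distribution function of the distance to the centre: continuous
  because spheres are null, 0 below radius 0, and strictly increasing from there because annuli are
  charged. So the definite description has exactly one solution, and it is used afterwards only
  through this equivalence.\<close>

lemma credible_radius_le_iff: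
  assumes \<tau>: "0 < \<tau>" "\<tau> \<le> 1" and \<alpha>: "0 < \<alpha>" "\<alpha> < 1" and "1 \<le> n"
  shows "credible_radius n \<alpha> \<tau> y \<le> t \<longleftrightarrow> 1 - \<alpha> \<le> ball_mass n \<tau> y t"
proof -
  let ?P = "posterior n \<tau> y"
  let ?F = "ball_mass n \<tau> y"
  define c where "c = posterior_mean n \<tau> y"
  interpret P: prob_space ?P using \<tau> by (rule prob_space_posterior)
  have dist [measurable]: "(\<lambda>\<theta>. l2_dist n \<theta> c) \<in> borel_measurable ?P"
    by measurable
  interpret D: real_distribution "distr ?P borel (\<lambda>\<theta>. l2_dist n \<theta> c)"
    by (rule P.real_distribution_distr) measurable
  have cdf: "cdf (distr ?P borel (\<lambda>\<theta>. l2_dist n \<theta> c)) = ?F"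
    unfolding cdf_def ball_mass_def c_def[symmetric]
    by (subst measure_distr) (auto simp: fun_eq_iff intro!: arg_cong[where f = "measure ?P"])
  have cont: "isCont ?F x" for x
  proof -
    have "emeasure ?P {\<theta> \<in> space ?P. l2_dist n \<theta> c = x} = 0"
      unfolding posterior_eq[OF \<tau>]
      by (rule product_sphere_null)
         (use \<tau> \<open>1 \<le> n\<close> in \<open>auto intro: prob_space_coord_posterior coord_posterior_singleton\<close>)
    then have "measure (distr ?P borel (\<lambda>\<theta>. l2_dist n \<theta> c)) {x} = 0"
      by (subst measure_distr) (auto simp: measure_def vimage_def Int_def conj_commute)
    then show ?thesis unfolding cdf[symmetric] D.isCont_cdf .
  qed
  have mono: "?F s \<le> ?F t" if "s \<le> t" for s t
    unfolding cdf[symmetric] by (rule D.cdf_nondecreasing[OF that])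
  have neg: "?F t = 0" if "t < 0" for t
  proof -
    have "{\<theta> \<in> space ?P. l2_dist n \<theta> c \<le> t} = {}"
      using that by (auto simp: not_le intro: less_le_trans[OF _ l2_dist_nonneg])
    then show ?thesis unfolding ball_mass_def c_def[symmetric] by (simp only: measure_empty)
  qed
  have strict: "?F s < ?F t" if "0 \<le> s" "s < t" for s t
  proof -
    let ?A = "{\<theta> \<in> space ?P. s < l2_dist n \<theta> c \<and> l2_dist n \<theta> c \<le> t}"
    have "0 < measure ?P ?A"
      unfolding posterior_eq[OF \<tau>]
      by (rule product_annulus_pos)
         (use \<tau> \<open>1 \<le> n\<close> that in \<open>auto intro: prob_space_coord_posterior coord_posterior_Icc_pos\<close>)
    moreover have "?F t = ?F s + measure ?P ?A"
      unfolding ball_mass_def c_def[symmetric] using that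
      by (subst P.finite_measure_Union[symmetric]) (auto intro!: arg_cong[where f = "measure ?P"])
    ultimately show ?thesis by simp
  qed
  have "eventually (\<lambda>R. 1 - \<alpha> < ?F R) at_top"
    using D.cdf_lim_at_top_prob \<alpha> unfolding cdf by (intro order_tendstoD(1)) auto
  \<comment> \<open>The left end -1 for the intermediate value theorem is a radius at which the ball
    mass is certainly 0.\<close>
  then obtain R where R: "-1 \<le> R" "1 - \<alpha> < ?F R"
    using eventually_happens[OF eventually_conj[OF _ eventually_ge_at_top[of "-1::real"]]] by auto
  then obtain r where r: "?F r = 1 - \<alpha>"
    using IVT[of ?F "-1" "1 - \<alpha>" R] neg[of "-1"] cont \<alpha> by auto
  have pos: "0 \<le> x" if "?F x = 1 - \<alpha>" for x
    using neg[of x] that \<alpha> by (cases "x < 0") auto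
  have "credible_radius n \<alpha> \<tau> y = r"
    unfolding credible_radius_def ball_mass_def[symmetric]
  proof (rule the_equality[of "\<lambda>x. ?F x = 1 - \<alpha>", OF r])
    fix x assume x: "?F x = 1 - \<alpha>"
    show "x = r"
      using strict[of x r] strict[of r x] pos[OF x] pos[OF r] x r by (cases x r rule: linorder_cases) auto
  qed
  moreover have "r \<le> t \<longleftrightarrow> 1 - \<alpha> \<le> ?F t"
  proof
    assume "1 - \<alpha> \<le> ?F t"
    show "r \<le> t"
    proof (rule ccontr)
      assume "\<not> r \<le> t"
      then show False
        using strict[of t r] neg[of t] r \<open>1 - \<alpha> \<le> ?F t\<close> \<alpha> by (cases "t < 0") auto
    qed
  qed (use mono[of r t] r in auto)
  ultimately show ?thesis by simp
qed

text \<open>The posterior depends on the data, but its mass of a ball is an integral against the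
  prior, which does not; the integrand is jointly measurable in data and parameter.\<close>

lemma measurable_ball_mass:
  assumes \<tau>: "0 < \<tau>" "\<tau> \<le> 1"
  shows "(\<lambda>y. ball_mass n \<tau> y t) \<in> borel_measurable (\<Pi>\<^sub>M i\<in>{1..n}. borel)"
proof -
  let ?Y = "\<Pi>\<^sub>M i\<in>{1..n}. (borel :: real measure)"
  let ?H = "horseshoe_prior n \<tau>"
  have sets_H [measurable_cong]: "sets ?H = sets ?Y"
    unfolding horseshoe_prior_def by (simp cong: sets_PiM_cong)
  note [measurable] = measurable_coord_mean[OF \<tau>(1)] measurable_evidence[OF \<tau>(1)]
  interpret H: prob_space ?H
    unfolding horseshoe_prior_def by (rule prob_space_PiM) (rule prob_space_horseshoe_coord[OF \<tau>(1)])
  define m where "m = (\<lambda>y. \<lambda>i\<in>{1..n}. coord_mean \<tau> (y i))"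
  have [measurable]: "(\<lambda>x. likelihood n (fst x) (snd x)) \<in> borel_measurable (?Y \<Otimes>\<^sub>M ?Y)"
    unfolding likelihood_def by measurable
  have [measurable]: "likelihood n y \<in> borel_measurable ?Y" for y
    unfolding likelihood_def by measurable
  have m [measurable]: "(\<lambda>x. m (fst x) i) \<in> borel_measurable (?Y \<Otimes>\<^sub>M ?Y)" if "i \<in> {1..n}" for i
    using that unfolding m_def by simp
  have "ball_mass n \<tau> y t = enn2real (\<integral>\<^sup>+\<theta>. ennreal (likelihood n y \<theta> / (\<Prod>i\<in>{1..n}. evidence \<tau> (y i)))
      * indicator {..t} (l2_dist n \<theta> (m y)) \<partial>?H)" for y
  proof -
    have "posterior_mean n \<tau> y = m y" by (simp add: m_def posterior_mean_eq[OF \<tau>])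
    note mean = this
    have "emeasure (posterior n \<tau> y) {\<theta> \<in> space ?Y. l2_dist n \<theta> (m y) \<le> t} =
        (\<integral>\<^sup>+\<theta>. ennreal (likelihood n y \<theta> / (\<Prod>i\<in>{1..n}. evidence \<tau> (y i)))
          * indicator {\<theta> \<in> space ?Y. l2_dist n \<theta> (m y) \<le> t} \<theta> \<partial>?H)"
      unfolding posterior_def integral_likelihood[OF \<tau>(1)] by (subst emeasure_density) measurable
    also have "\<dots> = (\<integral>\<^sup>+\<theta>. ennreal (likelihood n y \<theta> / (\<Prod>i\<in>{1..n}. evidence \<tau> (y i)))
          * indicator {..t} (l2_dist n \<theta> (m y)) \<partial>?H)"
      using sets_eq_imp_space_eq[of ?H ?Y] sets_H
      by (intro nn_integral_cong) (auto split: split_indicator)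
    finally show ?thesis
      unfolding ball_mass_def measure_def mean by simp
  qed
  moreover have "(\<lambda>y. enn2real (\<integral>\<^sup>+\<theta>. ennreal (likelihood n y \<theta> / (\<Prod>i\<in>{1..n}. evidence \<tau> (y i)))
      * indicator {..t} (l2_dist n \<theta> (m y)) \<partial>?H)) \<in> borel_measurable ?Y"
    by measurable
  ultimately show ?thesis by simp
qed

lemma measurable_credible_radius:
  assumes "0 < \<tau>" "\<tau> \<le> 1" "0 < \<alpha>" "\<alpha> < 1" "1 \<le> n"
  shows "credible_radius n \<alpha> \<tau> \<in> borel_measurable (\<Pi>\<^sub>M i\<in>{1..n}. borel)"
  unfolding borel_measurable_iff_le credible_radius_le_iff[OF assms]
proof (intro allI)
  fix t
  note [measurable] = measurable_ball_mass[OF assms(1,2), of n t]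
  show "{y \<in> space (\<Pi>\<^sub>M i\<in>{1..n}. borel). 1 - \<alpha> \<le> ball_mass n \<tau> y t} \<in> sets (\<Pi>\<^sub>M i\<in>{1..n}. borel)"
    by measurable
qed

section \<open>The data law, the error of the posterior mean and the size of the radius\<close>

lemma sets_data_law [simp, measurable_cong]: "sets (data_law n \<theta>) = sets (\<Pi>\<^sub>M i\<in>{1..n}. borel)"
  unfolding data_law_def by (simp cong: sets_PiM_cong)

lemma space_data_law [simp]: "space (data_law n \<theta>) = space (\<Pi>\<^sub>M i\<in>{1..n}. borel)"
  by (rule sets_eq_imp_space_eq) simp

lemma prob_space_data_law: "prob_space (data_law n \<theta>)"
  unfolding data_law_def by (rule prob_space_PiM) (simp add: prob_space_normal_density)

lemma nn_integral_data_law_component: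
  assumes "i \<in> {1..n}" and [measurable]: "f \<in> borel_measurable borel"
  shows "(\<integral>\<^sup>+y. f (y i) \<partial>data_law n \<theta>) = (\<integral>\<^sup>+t. f t \<partial>density lborel (normal_density (\<theta> i) 1))"
proof -
  have "(\<integral>\<^sup>+t. f t \<partial>density lborel (normal_density (\<theta> i) 1)) =
      (\<integral>\<^sup>+t. f t \<partial>distr (data_law n \<theta>) (density lborel (normal_density (\<theta> i) 1)) (\<lambda>y. y i))"
    unfolding data_law_def
    by (subst distr_PiM_component) (use assms(1) in \<open>auto simp: prob_space_normal_density\<close>)
  also have "\<dots> = (\<integral>\<^sup>+y. f (y i) \<partial>data_law n \<theta>)"
    using assms(1) by (subst nn_integral_distr) auto
  finally show ?thesis ..
qed

text \<open>The squared error is summed over the coordinates. The bound at zero is charged to all n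
  of them, the larger bound only to the at most p nonzero ones.\<close>

lemma posterior_mean_risk:
  assumes \<tau>: "0 < \<tau>" "\<tau> \<le> 1" and \<zeta>: "2 \<le> horseshoe_threshold \<tau>" and \<theta>: "\<theta> \<in> sparse_vectors n p"
  shows "(\<integral>\<^sup>+y. ennreal ((l2_dist n \<theta> (posterior_mean n \<tau> y))\<^sup>2) \<partial>data_law n \<theta>) \<le>
    ennreal (real p * (5409 * (horseshoe_threshold \<tau>)\<^sup>2) + real n * (22 * (\<tau> * horseshoe_threshold \<tau>)))"
proof -
  note [measurable] = measurable_coord_mean[OF \<tau>(1)]
  define a where "a = 5409 * (horseshoe_threshold \<tau>)\<^sup>2"
  define b where "b = 22 * (\<tau> * horseshoe_threshold \<tau>)"
  have ab: "0 \<le> a" "0 \<le> b" using \<tau> \<zeta> by (auto simp: a_def b_def)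
  let ?S = "{i \<in> {1..n}. \<theta> i \<noteq> 0}"
  have "(\<integral>\<^sup>+y. ennreal ((l2_dist n \<theta> (posterior_mean n \<tau> y))\<^sup>2) \<partial>data_law n \<theta>)
      = (\<integral>\<^sup>+y. (\<Sum>i\<in>{1..n}. ennreal ((\<theta> i - coord_mean \<tau> (y i))\<^sup>2)) \<partial>data_law n \<theta>)"
  proof (rule nn_integral_cong)
    fix y
    have "(l2_dist n \<theta> (posterior_mean n \<tau> y))\<^sup>2 = (\<Sum>i\<in>{1..n}. (\<theta> i - coord_mean \<tau> (y i))\<^sup>2)"
      unfolding l2_dist_power2 posterior_mean_eq[OF \<tau>] by (intro sum.cong) auto
    then show "ennreal ((l2_dist n \<theta> (posterior_mean n \<tau> y))\<^sup>2) = (\<Sum>i\<in>{1..n}. ennreal ((\<theta> i - coord_mean \<tau> (y i))\<^sup>2))"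
      by (subst sum_ennreal) auto
  qed
  also have "\<dots> = (\<Sum>i\<in>{1..n}. \<integral>\<^sup>+y. ennreal ((\<theta> i - coord_mean \<tau> (y i))\<^sup>2) \<partial>data_law n \<theta>)"
    by (rule nn_integral_sum) measurable
  also have "\<dots> \<le> (\<Sum>i\<in>{1..n}. ennreal (a * indicator ?S i + b))"
  proof (rule sum_mono)
    fix i assume i: "i \<in> {1..n}"
    have "(\<integral>\<^sup>+y. ennreal ((\<theta> i - coord_mean \<tau> (y i))\<^sup>2) \<partial>data_law n \<theta>) =
        (\<integral>\<^sup>+t. ennreal ((\<theta> i - coord_mean \<tau> t)\<^sup>2) \<partial>density lborel (normal_density (\<theta> i) 1))"
      by (rule nn_integral_data_law_component[OF i]) measurable
    also have "\<dots> \<le> ennreal (a * indicator ?S i + b)"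
    proof (cases "\<theta> i = 0")
      case True
      then show ?thesis using risk_at_zero[OF \<tau> \<zeta>] by (simp add: b_def)
    next
      case False
      have "(\<integral>\<^sup>+t. ennreal ((\<theta> i - coord_mean \<tau> t)\<^sup>2) \<partial>density lborel (normal_density (\<theta> i) 1)) \<le> ennreal a"
        unfolding a_def by (rule risk_le[OF \<tau> \<zeta>])
      also have "\<dots> \<le> ennreal (a * indicator ?S i + b)"
        using False i ab by (intro ennreal_leI) simp
      finally show ?thesis .
    qed
    finally show "(\<integral>\<^sup>+y. ennreal ((\<theta> i - coord_mean \<tau> (y i))\<^sup>2) \<partial>data_law n \<theta>) \<le> ennreal (a * indicator ?S i + b)" .
  qed
  also have "\<dots> = ennreal (\<Sum>i\<in>{1..n}. a * indicator ?S i + b)"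
    using ab by (intro sum_ennreal) auto
  also have "\<dots> \<le> ennreal (real p * a + real n * b)"
  proof (rule ennreal_leI)
    have "(\<Sum>i\<in>{1..n}. a * indicator ?S i + b) = a * (\<Sum>i\<in>{1..n}. indicator ?S i) + real n * b"
      by (simp add: sum.distrib sum_distrib_left)
    also have "(\<Sum>i\<in>{1..n}. indicator ?S i :: real) = real (card ?S)"
    proof -
      have "{1..n} \<inter> ?S = ?S" by auto
      then show ?thesis by (simp only: indicator_def sum_of_bool_eq finite_atLeastAtMost Collect_mem_eq)
    qed
    also have "a * real (card ?S) \<le> a * real p"
      using \<theta> ab by (intro mult_left_mono) (auto simp: sparse_vectors_def)
    finally show "(\<Sum>i\<in>{1..n}. a * indicator ?S i + b) \<le> real p * a + real n * b"
      by (simp add: mult.commute)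
  qed
  finally show ?thesis by (simp add: a_def b_def)
qed

text \<open>Here \<open>1327104 = 8 * 165888\<close>: at least half of the coordinates are zero, and
  \<open>product_lower_tail\<close> compares a sum with a quarter of its mean.\<close>

lemma credible_radius_small_prob:
  assumes \<tau>: "0 < \<tau>" "\<tau> \<le> 1" and \<zeta>: "2 \<le> horseshoe_threshold \<tau>" and \<theta>: "\<theta> \<in> sparse_vectors n p"
    and n: "1 \<le> n" "2 * p \<le> n" and \<alpha>: "0 < \<alpha>" "\<alpha> < 1"
  defines "U \<equiv> real n * (\<tau> * horseshoe_threshold \<tau>) / 1327104"
  assumes small: "exp (- U / (4 * (horseshoe_threshold \<tau>)\<^sup>2)) < 1 - \<alpha>"
  shows "measure (data_law n \<theta>) {y \<in> space (data_law n \<theta>). credible_radius n \<alpha> \<tau> y \<le> sqrt (U / 4)}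
    \<le> exp (- U / (4 * (horseshoe_threshold \<tau>)\<^sup>2))"
proof -
  define \<zeta> where "\<zeta> = horseshoe_threshold \<tau>"
  have \<zeta>0: "0 < \<zeta>" using \<zeta> by (simp add: \<zeta>_def)
  \<comment> \<open>Nonzero coordinates get the value 0, since the lower bound on the mean truncated
    variance is available only for standard normal data.\<close>
  define v where "v = (\<lambda>i t. if \<theta> i = 0 then truncated_variance \<tau> t else 0)"
  note [measurable] = measurable_truncated_variance[OF \<tau>]
  interpret P: prob_space "data_law n \<theta>" by (rule prob_space_data_law)
  define \<mu> where "\<mu> = (\<Sum>i\<in>{1..n}. \<integral>t. v i t \<partial>density lborel (normal_density (\<theta> i) 1))"
  have \<mu>: "4 * U \<le> \<mu>"
  proof -
    let ?J = "{i \<in> {1..n}. \<theta> i = 0}"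
    have "n = card ?J + card {i \<in> {1..n}. \<theta> i \<noteq> 0}"
    proof -
      have "{1..n} = ?J \<union> {i \<in> {1..n}. \<theta> i \<noteq> 0}" by auto
      then have "card {1..n} = card (?J \<union> {i \<in> {1..n}. \<theta> i \<noteq> 0})" by (rule arg_cong)
      then show ?thesis by (subst (asm) card_Un_disjoint) auto
    qed
    then have "real n / 2 \<le> real (card ?J)"
      using \<theta> n by (auto simp: sparse_vectors_def)
    then have "real n / 2 * (\<tau> * \<zeta> / 165888) \<le> real (card ?J) * (\<tau> * \<zeta> / 165888)"
      using \<tau> \<zeta>0 by (intro mult_right_mono) auto
    also have "\<dots> = (\<Sum>i\<in>?J. \<tau> * \<zeta> / 165888)" by simp
    also have "\<dots> \<le> (\<Sum>i\<in>?J. \<integral>t. v i t \<partial>density lborel (normal_density (\<theta> i) 1))"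
      using integral_truncated_variance_ge[OF \<tau> \<zeta>] by (intro sum_mono) (auto simp: v_def \<zeta>_def)
    also have "\<dots> = \<mu>"
      unfolding \<mu>_def by (rule sum.mono_neutral_left) (auto simp: v_def)
    finally show ?thesis by (simp add: U_def \<zeta>_def mult_ac)
  qed
  have U0: "0 \<le> U" using \<tau> \<zeta>0 by (simp add: U_def \<zeta>_def)
  \<comment> \<open>The tail bound under the posterior: if the truncated variances sum to more than
    U, the centred ball of squared radius U / 4 has posterior mass below 1 - \<alpha>, so the
    credible radius is larger.\<close>
  have sub: "sqrt (U / 4) < credible_radius n \<alpha> \<tau> y" if V: "U < (\<Sum>i\<in>{1..n}. v i (y i))" for y
  proof -
    define w where "w = (\<lambda>i t. if \<theta> i = 0 then min ((t - coord_mean \<tau> (y i))\<^sup>2) (\<zeta>\<^sup>2) else 0)"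
    define V where "V = (\<Sum>i\<in>{1..n}. \<integral>t. w i t \<partial>coord_posterior \<tau> (y i))"
    have V_eq: "V = (\<Sum>i\<in>{1..n}. v i (y i))"
      unfolding V_def by (intro sum.cong refl) (simp add: v_def w_def truncated_variance_def \<zeta>_def)
    interpret Q: prob_space "posterior n \<tau> y" using \<tau> by (rule prob_space_posterior)
    have w_meas [measurable]: "w i \<in> borel_measurable borel" for i unfolding w_def by measurable
    have "ball_mass n \<tau> y (sqrt (U / 4)) \<le> measure (posterior n \<tau> y)
        {x \<in> space (posterior n \<tau> y). (\<Sum>i\<in>{1..n}. w i (x i)) \<le> V / 4}"
      unfolding ball_mass_def
    proof (rule Q.finite_measure_mono)
      show "{x \<in> space (posterior n \<tau> y). (\<Sum>i\<in>{1..n}. w i (x i)) \<le> V / 4} \<in> sets (posterior n \<tau> y)"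
        by measurable
      show "{x \<in> space (posterior n \<tau> y). l2_dist n x (posterior_mean n \<tau> y) \<le> sqrt (U / 4)} \<subseteq>
          {x \<in> space (posterior n \<tau> y). (\<Sum>i\<in>{1..n}. w i (x i)) \<le> V / 4}"
      proof safe
        fix x assume "l2_dist n x (posterior_mean n \<tau> y) \<le> sqrt (U / 4)"
        then have "(\<Sum>i\<in>{1..n}. (x i - posterior_mean n \<tau> y i)\<^sup>2) \<le> U / 4"
          using U0 by (subst (asm) l2_dist_le_iff) auto
        moreover have "(\<Sum>i\<in>{1..n}. w i (x i)) \<le> (\<Sum>i\<in>{1..n}. (x i - posterior_mean n \<tau> y i)\<^sup>2)"
          by (rule sum_mono) (auto simp: w_def posterior_mean_eq[OF \<tau>])
        ultimately show "(\<Sum>i\<in>{1..n}. w i (x i)) \<le> V / 4" using V by (simp add: V_eq)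
      qed
    qed
    also have "\<dots> \<le> exp (- V / (4 * \<zeta>\<^sup>2))"
      unfolding posterior_eq[OF \<tau>] V_def
      by (rule product_lower_tail) (use \<zeta>0 in \<open>auto intro: prob_space_coord_posterior[OF \<tau>] simp: w_def\<close>)
    also have "\<dots> \<le> exp (- U / (4 * \<zeta>\<^sup>2))"
      using V \<zeta>0 by (simp add: V_eq divide_right_mono)
    also have "\<dots> < 1 - \<alpha>" using small by (simp add: \<zeta>_def)
    finally show ?thesis
      using credible_radius_le_iff[OF \<tau> \<alpha> n(1), of y "sqrt (U / 4)"] by linarith
  qed
  \<comment> \<open>The tail bound under the data law: that sum is at most U \<le> \<mu> / 4 only
    with exponentially small probability.\<close>
  have "measure (data_law n \<theta>) {y \<in> space (data_law n \<theta>). credible_radius n \<alpha> \<tau> y \<le> sqrt (U / 4)}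
      \<le> measure (data_law n \<theta>) {y \<in> space (data_law n \<theta>). (\<Sum>i\<in>{1..n}. v i (y i)) \<le> \<mu> / 4}"
  proof (rule P.finite_measure_mono)
    have [measurable]: "v i \<in> borel_measurable borel" for i unfolding v_def by measurable
    show "{y \<in> space (data_law n \<theta>). (\<Sum>i\<in>{1..n}. v i (y i)) \<le> \<mu> / 4} \<in> sets (data_law n \<theta>)"
      by measurable
    show "{y \<in> space (data_law n \<theta>). credible_radius n \<alpha> \<tau> y \<le> sqrt (U / 4)} \<subseteq>
        {y \<in> space (data_law n \<theta>). (\<Sum>i\<in>{1..n}. v i (y i)) \<le> \<mu> / 4}"
    proof safe
      fix y assume "credible_radius n \<alpha> \<tau> y \<le> sqrt (U / 4)"
      then have "(\<Sum>i\<in>{1..n}. v i (y i)) \<le> U" using sub[of y] by linarith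
      then show "(\<Sum>i\<in>{1..n}. v i (y i)) \<le> \<mu> / 4" using \<mu> by linarith
    qed
  qed
  also have "\<dots> \<le> exp (- \<mu> / (4 * \<zeta>\<^sup>2))"
    unfolding data_law_def \<mu>_def
    by (rule product_lower_tail)
       (use \<zeta>0 truncated_variance_bounds[OF \<tau>] in \<open>auto simp: prob_space_normal_density v_def \<zeta>_def\<close>)
  also have "\<dots> \<le> exp (- U / (4 * \<zeta>\<^sup>2))"
    using \<mu> U0 by (simp add: divide_right_mono)
  finally show ?thesis by (simp add: \<zeta>_def)
qed

text \<open>Here \<open>10616832 = 8 * 1327104\<close>, which turns the bound on \<open>p\<close> times the threshold into
  \<open>p / 10616832 \<le> U / (4 \<zeta>\<^sup>2)\<close>, and \<open>L\<^sup>2 * \<alpha>\<close> only has to exceed \<open>2 * 4 * 1327104 * 10840\<close>.\<close>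

lemma coverage_ge:
  assumes \<tau>: "0 < \<tau>" "\<tau> \<le> 1" and \<zeta>: "2 \<le> horseshoe_threshold \<tau>" and \<theta>: "\<theta> \<in> sparse_vectors n p"
    and n: "1 \<le> n" "2 * p \<le> n" and \<alpha>: "0 < \<alpha>" "\<alpha> < 1"
    and p: "real p * horseshoe_threshold \<tau> \<le> 2 * real n * \<tau>"
    and small: "exp (- real p / 10616832) < 1 - \<alpha>" "exp (- real p / 10616832) \<le> \<alpha> / 2"
    and L: "0 < L" "L\<^sup>2 * \<alpha> = 120000000000"
  shows "1 - \<alpha> \<le> measure (data_law n \<theta>)
    {y \<in> space (data_law n \<theta>). \<theta> \<in> credible_ball n \<alpha> L \<tau> y}"
proof -
  define \<zeta> where "\<zeta> = horseshoe_threshold \<tau>"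
  define N where "N = real n * (\<tau> * \<zeta>)"
  define U where "U = N / 1327104"
  have \<zeta>0: "0 < \<zeta>" using \<zeta> by (simp add: \<zeta>_def)
  have N: "0 < N" using \<tau> \<zeta>0 n by (simp add: N_def)
  interpret P: prob_space "data_law n \<theta>" by (rule prob_space_data_law)
  note [measurable] = measurable_credible_radius[OF \<tau> \<alpha> n(1)] measurable_coord_mean[OF \<tau>(1)]
  let ?S = "space (data_law n \<theta>)"
  let ?d = "\<lambda>y. l2_dist n \<theta> (posterior_mean n \<tau> y)"
  have [measurable]: "?d \<in> borel_measurable (data_law n \<theta>)"
    unfolding posterior_mean_eq[OF \<tau>] by (rule measurable_l2_dist) simp_all
  \<comment> \<open>Coverage can fail only if the radius is small (\<open>?A\<close>) or the error
    is large (\<open>?B\<close>); each event gets probability at most \<alpha> / 2.\<close>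
  let ?A = "{y \<in> ?S. credible_radius n \<alpha> \<tau> y \<le> sqrt (U / 4)}"
  let ?B = "{y \<in> ?S. L\<^sup>2 * U / 4 \<le> (?d y)\<^sup>2}"
  let ?G = "{y \<in> ?S. \<theta> \<in> credible_ball n \<alpha> L \<tau> y}"
  have "real p / 10616832 \<le> U / (4 * \<zeta>\<^sup>2)"
  proof -
    have "real p * \<zeta>\<^sup>2 \<le> 2 * N"
      using mult_right_mono[OF p, of \<zeta>] \<zeta>0 by (simp add: N_def \<zeta>_def power2_eq_square mult_ac)
    then show ?thesis using \<zeta>0 by (simp add: U_def field_simps)
  qed
  then have "exp (- U / (4 * \<zeta>\<^sup>2)) \<le> exp (- real p / 10616832)" by simp
  then have e: "exp (- U / (4 * \<zeta>\<^sup>2)) < 1 - \<alpha>" "exp (- U / (4 * \<zeta>\<^sup>2)) \<le> \<alpha> / 2" using small by linarith+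
  have A: "measure (data_law n \<theta>) ?A \<le> \<alpha> / 2"
    using credible_radius_small_prob[OF \<tau> \<zeta> \<theta> n \<alpha>] e unfolding U_def N_def \<zeta>_def by linarith
  have B: "measure (data_law n \<theta>) ?B \<le> \<alpha> / 2"
  proof -
    have "(\<integral>\<^sup>+y. ennreal ((?d y)\<^sup>2) \<partial>data_law n \<theta>) \<le> ennreal (real p * (5409 * \<zeta>\<^sup>2) + real n * (22 * (\<tau> * \<zeta>)))"
      unfolding \<zeta>_def by (rule posterior_mean_risk[OF \<tau> \<zeta> \<theta>])
    \<comment> \<open>By the bound on \<open>p\<close>, the nonzero coordinates contribute at most 2
      * 5409 N; adding 22 N gives 10840 N.\<close>
    also have "\<dots> \<le> ennreal (10840 * N)"
      using mult_right_mono[OF p, of \<zeta>] \<zeta>0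
      by (intro ennreal_leI) (simp add: N_def \<zeta>_def power2_eq_square mult_ac)
    finally have int: "(\<integral>\<^sup>+y. ennreal ((?d y)\<^sup>2) \<partial>data_law n \<theta>) \<le> ennreal (10840 * N)" .
    then have "integrable (data_law n \<theta>) (\<lambda>y. (?d y)\<^sup>2)"
      by (intro integrableI_nonneg) (auto simp: le_less_trans)
    moreover have "(\<integral>y. (?d y)\<^sup>2 \<partial>data_law n \<theta>) \<le> 10840 * N"
      using int N by (intro integral_real_bounded) auto
    ultimately have "measure (data_law n \<theta>) ?B \<le> 10840 * N / (L\<^sup>2 * U / 4)"
      using N L by (intro order.trans[OF integral_Markov_inequality_measure[where A = "{}"]] divide_right_mono) (auto simp: U_def)
    also have "\<dots> \<le> \<alpha> / 2"
    proof -
      have "\<alpha> * (L\<^sup>2 * U / 4) = 120000000000 * U / 4" using L(2) by (simp add: mult_ac)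
      then have "10840 * N \<le> \<alpha> / 2 * (L\<^sup>2 * U / 4)" using N by (simp add: U_def)
      then show ?thesis using N L by (simp add: divide_le_eq U_def)
    qed
    finally show ?thesis .
  qed
  have G_iff: "\<theta> \<in> credible_ball n \<alpha> L \<tau> y \<longleftrightarrow> ?d y \<le> L * credible_radius n \<alpha> \<tau> y" for y
    using \<theta> by (simp add: credible_ball_def sparse_vectors_def)
  have G [measurable]: "?G \<in> sets (data_law n \<theta>)" unfolding G_iff by measurable
  have "?S - ?G \<subseteq> ?A \<union> ?B"
  proof
    fix y assume y: "y \<in> ?S - ?G"
    then have d: "L * credible_radius n \<alpha> \<tau> y < ?d y" by (auto simp: G_iff)
    show "y \<in> ?A \<union> ?B"
    proof (cases "credible_radius n \<alpha> \<tau> y \<le> sqrt (U / 4)")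
      case False
      then have "L * sqrt (U / 4) \<le> L * credible_radius n \<alpha> \<tau> y" using L by simp
      with d have "L * sqrt (U / 4) \<le> ?d y" by linarith
      then have "(L * sqrt (U / 4))\<^sup>2 \<le> (?d y)\<^sup>2" using L N by (intro power_mono) (auto simp: U_def)
      moreover have "(L * sqrt (U / 4))\<^sup>2 = L\<^sup>2 * U / 4" using N by (simp add: power_mult_distrib U_def)
      ultimately show ?thesis using y by simp
    qed (use y in auto)
  qed
  then have "measure (data_law n \<theta>) (?S - ?G) \<le> measure (data_law n \<theta>) (?A \<union> ?B)"
    by (rule P.finite_measure_mono) measurable
  also have "\<dots> \<le> measure (data_law n \<theta>) ?A + measure (data_law n \<theta>) ?B"
    by (rule measure_Un_le) measurable
  also have "\<dots> \<le> \<alpha>" using A B by simp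
  finally show ?thesis using P.prob_compl[OF G] by simp
qed

text \<open>With x = n / p at least 3, and hence above e, the rate condition gives \<tau> \<ge> 1 /
  x. The threshold is therefore at most 2 sqrt (ln x), and p times this is again controlled by the
  rate condition. Consequently p \<zeta>^2 is at most 2 n \<tau> \<zeta>.\<close>

lemma threshold_rate:
  assumes "0 < \<tau>" "\<tau> < 1" "1 \<le> p" "3 * p \<le> n" and rate: "\<tau> \<ge> real p / real n * sqrt (ln (real n / real p))"
  shows "real p * horseshoe_threshold \<tau> \<le> 2 * real n * \<tau>"
proof -
  define x where "x = real n / real p"
  have x: "3 \<le> x" using assms(3,4) by (simp add: x_def field_simps)
  then have "exp 1 \<le> x" using exp_le by linarith
  then have ln: "1 \<le> ln x" using x by (simp add: ln_ge_iff)
  have xi: "real p / real n = 1 / x" by (simp add: x_def)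
  have "1 / x * 1 \<le> 1 / x * sqrt (ln x)" using ln x by (intro mult_left_mono) auto
  with rate have "1 / x \<le> \<tau>" by (simp add: xi x_def[symmetric])
  then have "1 / \<tau> \<le> x" using assms x by (simp add: field_simps)
  then have "ln (1 / \<tau>) \<le> ln x" using assms x by (intro ln_mono) auto
  then have "horseshoe_threshold \<tau> \<le> sqrt (4 * ln x)"
    unfolding horseshoe_threshold_def using ln by (intro real_sqrt_le_mono) auto
  then have "horseshoe_threshold \<tau> \<le> 2 * sqrt (ln x)" by (simp add: real_sqrt_mult)
  then have "real p * horseshoe_threshold \<tau> \<le> real p * (2 * sqrt (ln x))" by (intro mult_left_mono) auto
  also have "\<dots> = 2 * real n * (real p / real n * sqrt (ln x))" using assms by simp
  also have "\<dots> \<le> 2 * real n * \<tau>" using rate by (intro mult_left_mono) (auto simp: x_def)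
  finally show ?thesis .
qed

lemma horseshoe_threshold_ge_2:
  assumes "0 < \<tau>" "\<tau> \<le> exp (- 2)"
  shows "2 \<le> horseshoe_threshold \<tau>"
proof -
  have "ln \<tau> \<le> ln (exp (- 2))" using assms by (intro ln_mono) auto
  then have "2\<^sup>2 \<le> 2 * ln (1 / \<tau>)" using assms by (simp add: ln_div)
  then show ?thesis unfolding horseshoe_threshold_def by (intro real_le_rsqrt)
qed

theorem theorem4p2:
  fixes \<tau> :: "nat \<Rightarrow> real" and p :: "nat \<Rightarrow> nat" and \<alpha> :: real
  assumes "0 < \<alpha>" and "\<alpha> < 1"
    and "\<And>n. n \<ge> 1 \<Longrightarrow> 0 < \<tau> n \<and> \<tau> n < 1"
    and "\<And>n. n \<ge> 1 \<Longrightarrow> \<tau> n \<ge> tau_rate p n"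
    and "\<tau> \<longlonglongrightarrow> 0"
    and "filterlim p at_top sequentially"
    and "(\<lambda>n. real (p n)) \<in> o(\<lambda>n. real n)"
  shows "\<exists>L>0. liminf (\<lambda>n. INF \<theta>\<^sub>0\<in>sparse_vectors n (p n).
             ereal (measure (data_law n \<theta>\<^sub>0)
               {y \<in> space (data_law n \<theta>\<^sub>0). \<theta>\<^sub>0 \<in> credible_ball n \<alpha> L (\<tau> n) y}))
           \<ge> ereal (1 - \<alpha>)"
proof -
  \<comment> \<open>The value required by \<open>coverage_ge\<close>; it depends on \<alpha>
    alone.\<close>
  define L where "L = sqrt (120000000000 / \<alpha>)"
  have L: "0 < L" "L\<^sup>2 * \<alpha> = 120000000000" using assms(1) by (auto simp: L_def)
  have "((\<lambda>n. exp (- real (p n) / 10616832)) \<longlongrightarrow> 0) sequentially"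
  proof (rule filterlim_compose[OF _ assms(6)])
    show "((\<lambda>k. exp (- real k / 10616832)) \<longlongrightarrow> 0) sequentially" by real_asymp
  qed
  then have ev_small: "eventually (\<lambda>n. exp (- real (p n) / 10616832) < min (1 - \<alpha>) (\<alpha> / 2)) sequentially"
    using assms(1,2) by (intro order_tendstoD(2)) auto
  \<comment> \<open>The constant 1/3 serves both the sparsity 2 p \<le> n of
    \<open>coverage_ge\<close> and the condition 3 p \<le> n of
    \<open>threshold_rate\<close>.\<close>
  have ev_o: "eventually (\<lambda>n. norm (real (p n)) \<le> 1 / 3 * norm (real n)) sequentially"
    by (rule landau_o.smallD[OF assms(7)]) simp
  have ev_\<tau>: "eventually (\<lambda>n. \<tau> n < exp (- 2)) sequentially"
    using assms(5) by (intro order_tendstoD(2)) auto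
  have ev_p: "eventually (\<lambda>n. 1 \<le> p n) sequentially"
    using assms(6) by (simp add: filterlim_at_top)
  have "eventually (\<lambda>n. ereal (1 - \<alpha>) \<le> (INF \<theta>\<^sub>0\<in>sparse_vectors n (p n).
             ereal (measure (data_law n \<theta>\<^sub>0)
               {y \<in> space (data_law n \<theta>\<^sub>0). \<theta>\<^sub>0 \<in> credible_ball n \<alpha> L (\<tau> n) y}))) sequentially"
    using ev_small ev_o ev_\<tau> ev_p eventually_ge_at_top[of 1]
  proof eventually_elim
    case (elim n)
    have \<tau>: "0 < \<tau> n" "\<tau> n < 1" using assms(3) elim by auto
    have p: "3 * p n \<le> n" using elim(2) by simp
    show ?case
    proof (rule INF_greatest)
      fix \<theta>\<^sub>0 assume \<theta>: "\<theta>\<^sub>0 \<in> sparse_vectors n (p n)"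
      have "1 - \<alpha> \<le> measure (data_law n \<theta>\<^sub>0) {y \<in> space (data_law n \<theta>\<^sub>0). \<theta>\<^sub>0 \<in> credible_ball n \<alpha> L (\<tau> n) y}"
      proof (rule coverage_ge[OF _ _ _ \<theta>])
        show "\<tau> n \<le> 1" using \<tau> by simp
        show "real (p n) * horseshoe_threshold (\<tau> n) \<le> 2 * real n * \<tau> n"
          using \<tau> elim p assms(4)[of n] by (intro threshold_rate) (auto simp: tau_rate_def)
        show "2 \<le> horseshoe_threshold (\<tau> n)" using \<tau> elim by (intro horseshoe_threshold_ge_2) auto
      qed (use \<tau> elim p assms L in auto)
      then show "ereal (1 - \<alpha>) \<le> ereal (measure (data_law n \<theta>\<^sub>0)
          {y \<in> space (data_law n \<theta>\<^sub>0). \<theta>\<^sub>0 \<in> credible_ball n \<alpha> L (\<tau> n) y})" by simp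
    qed
  qed
  then have "ereal (1 - \<alpha>) \<le> liminf (\<lambda>n. INF \<theta>\<^sub>0\<in>sparse_vectors n (p n).
             ereal (measure (data_law n \<theta>\<^sub>0)
               {y \<in> space (data_law n \<theta>\<^sub>0). \<theta>\<^sub>0 \<in> credible_ball n \<alpha> L (\<tau> n) y}))"
    by (rule Liminf_bounded)
  with L(1) show ?thesis by blast
qed

end
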